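(* Let $G$ be a lacunary hyperbolic group and let $g\in G$ be an element of infinite order. Then $E^{\mathcal{L}}(g)$ has a locally finite normal subgroup $N\triangleleft E^{\mathcal{L}}(g)$ such that one of the following holds: (i) $E^{\mathcal{L}}(g)/N$ is an abelian group of rank $1$ (i.e. it embeds in $(\mathbb{Q},+)$); or (ii) $E^{\mathcal{L}}(g)/N$ is an extension of a rank one abelian group by the involutive automorphism $a\mapsto a^{-1}$, i.e. $E^{\mathcal{L}}(g)/N$ has a subgroup $A$ of index $2$ that is a rank one abelian group, and conjugation by elements outside $A$ acts on $A$ by $a\mapsto a^{-1}$.
   Context: A finitely generated group is lacunary hyperbolic if at least one asymptotic cone (for some non-principal ultrafilter, some scaling sequence tending to infinity and some choice of basepoints) of its Cayley graph with respect to a finite generating set is an $\mathbb{R}$-tree. For $g$ of infinite order in a lacunary hyperbolic group $G$, $E^{\mathcal{L}}(g)=\{x\in G : xg^nx^{-1}=g^{\pm n}\text{ for some } n=n(x)\in\mathbb{N}\setminus\{0\}\}$, which is a subgroup of $G$. A rank one abelian group means a nontrivial group isomorphic to a subgroup of $(\mathbb{Q},+)$. A group is locally finite if each of its finitely generated subgroups is finite. *)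

theory Defs
  imports "HOL-Analysis.Analysis" "HOL-Algebra.Coset" "HOL-Algebra.Generated_Groups"
begin

subsection \<open>Real trees\<close>

definition geodesic_segment ::
    "'a set \<Rightarrow> ('a \<Rightarrow> 'a \<Rightarrow> real) \<Rightarrow> 'a \<Rightarrow> 'a \<Rightarrow> 'a set \<Rightarrow> bool" where
  "geodesic_segment M d x y S \<longleftrightarrow>
     (\<exists>\<gamma>. \<gamma> \<in> {0..d x y} \<rightarrow> M \<and> \<gamma> 0 = x \<and> \<gamma> (d x y) = y \<and>
        (\<forall>t\<in>{0..d x y}. \<forall>u\<in>{0..d x y}. d (\<gamma> t) (\<gamma> u) = \<bar>t - u\<bar>) \<and>
        S = \<gamma> ` {0..d x y})"

text \<open>The definition of Bridson and Haefliger: geodesic segments exist and are unique, and two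
  segments that share only a common endpoint concatenate to a segment. The locale
  \<open>Metric_space\<close> asks for symmetry and nonnegativity on the whole type, so \<open>d\<close> is cut off
  outside \<open>M\<close>.\<close>

definition real_tree :: "'a set \<Rightarrow> ('a \<Rightarrow> 'a \<Rightarrow> real) \<Rightarrow> bool" where
  "real_tree M d \<longleftrightarrow>
     Metric_space M (\<lambda>x y. if x \<in> M \<and> y \<in> M then d x y else 0) \<and>
     (\<forall>x\<in>M. \<forall>y\<in>M. \<exists>!S. geodesic_segment M d x y S) \<and>
     (\<forall>x\<in>M. \<forall>y\<in>M. \<forall>z\<in>M. \<forall>S T.
        geodesic_segment M d x y S \<and> geodesic_segment M d y z T \<and> S \<inter> T = {y}
        \<longrightarrow> geodesic_segment M d x z (S \<union> T))"

subsection \<open>Asymptotic cones\<close>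

definition nonprincipal_ultrafilter :: "nat filter \<Rightarrow> bool" where
  "nonprincipal_ultrafilter \<omega> \<longleftrightarrow>
     \<omega> \<noteq> bot \<and>
     (\<forall>P. eventually P \<omega> \<or> eventually (\<lambda>n. \<not> P n) \<omega>) \<and>
     (\<forall>k. \<not> eventually (\<lambda>n. n = k) \<omega>)"

text \<open>Sequences at finite \<open>\<omega>\<close>-distance from the basepoint sequence \<open>e\<close>, for the metrics
  \<open>d / s n\<close>.\<close>

definition cone_seqs ::
    "'p set \<Rightarrow> ('p \<Rightarrow> 'p \<Rightarrow> real) \<Rightarrow> nat filter \<Rightarrow> (nat \<Rightarrow> real) \<Rightarrow> (nat \<Rightarrow> 'p) \<Rightarrow> (nat \<Rightarrow> 'p) set" where
  "cone_seqs X d \<omega> s e =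
     {x. (\<forall>n. x n \<in> X) \<and> (\<exists>C. eventually (\<lambda>n. d (x n) (e n) / s n \<le> C) \<omega>)}"

definition cone_rel ::
    "'p set \<Rightarrow> ('p \<Rightarrow> 'p \<Rightarrow> real) \<Rightarrow> nat filter \<Rightarrow> (nat \<Rightarrow> real) \<Rightarrow> (nat \<Rightarrow> 'p) \<Rightarrow>
     ((nat \<Rightarrow> 'p) \<times> (nat \<Rightarrow> 'p)) set" where
  "cone_rel X d \<omega> s e =
     {(x, y). x \<in> cone_seqs X d \<omega> s e \<and> y \<in> cone_seqs X d \<omega> s e \<and>
              ((\<lambda>n. d (x n) (y n) / s n) \<longlongrightarrow> 0) \<omega>}"

definition asymptotic_cone ::
    "'p set \<Rightarrow> ('p \<Rightarrow> 'p \<Rightarrow> real) \<Rightarrow> nat filter \<Rightarrow> (nat \<Rightarrow> real) \<Rightarrow> (nat \<Rightarrow> 'p) \<Rightarrow> (nat \<Rightarrow> 'p) set set" where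
  "asymptotic_cone X d \<omega> s e = cone_seqs X d \<omega> s e // cone_rel X d \<omega> s e"

text \<open>The value does not depend on the representatives that \<open>SOME\<close> picks, and the limit exists
  because the scaled distances are \<open>\<omega>\<close>-almost surely bounded.\<close>

definition cone_dist ::
    "('p \<Rightarrow> 'p \<Rightarrow> real) \<Rightarrow> nat filter \<Rightarrow> (nat \<Rightarrow> real) \<Rightarrow> (nat \<Rightarrow> 'p) set \<Rightarrow> (nat \<Rightarrow> 'p) set \<Rightarrow> real" where
  "cone_dist d \<omega> s \<xi> \<zeta> =
     Lim \<omega> (\<lambda>n. d ((SOME x. x \<in> \<xi>) n) ((SOME y. y \<in> \<zeta>) n) / s n)"

subsection \<open>Graphs as metric spaces\<close>

text \<open>A graph is given by its set of two-element edges. The combinatorial distance is meaningful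
  for connected vertices only.\<close>

definition vertex_dist :: "'v set set \<Rightarrow> 'v \<Rightarrow> 'v \<Rightarrow> nat" where
  "vertex_dist E x y = (LEAST n. (x, y) \<in> {(u, v). {u, v} \<in> E} ^^ n)"

text \<open>Geometric realization, in barycentric coordinates: a point is supported on a vertex or on
  an edge. On an edge \<open>{u, v}\<close> of length \<open>1\<close>, the point \<open>p\<close> is at distance \<open>1 - p u\<close> from \<open>u\<close>.\<close>

definition supp :: "('v \<Rightarrow> real) \<Rightarrow> 'v set" where
  "supp p = {v. p v \<noteq> 0}"

definition realization :: "'v set \<Rightarrow> 'v set set \<Rightarrow> ('v \<Rightarrow> real) set" where
  "realization V E =
     {p. (\<forall>v. 0 \<le> p v) \<and> (supp p \<in> E \<or> (\<exists>v\<in>V. supp p = {v})) \<and> (\<Sum>v\<in>supp p. p v) = 1}"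

text \<open>The path metric: two points inside the same edge are joined along that edge, and otherwise a
  shortest path leaves each point through a vertex of its support.\<close>

definition realization_dist :: "'v set set \<Rightarrow> ('v \<Rightarrow> real) \<Rightarrow> ('v \<Rightarrow> real) \<Rightarrow> real" where
  "realization_dist E p q =
     (if supp p = supp q then (\<Sum>v\<in>supp p. \<bar>p v - q v\<bar>) / 2
      else Min ((\<lambda>(u, v). (1 - p u) + real (vertex_dist E u v) + (1 - q v)) ` (supp p \<times> supp q)))"

subsection \<open>Lacunary hyperbolic groups\<close>

text \<open>The Cayley graph is taken without loops and multiple edges.\<close>

definition cayley_edges :: "('a, 'b) monoid_scheme \<Rightarrow> 'a set \<Rightarrow> 'a set set" where
  "cayley_edges G S = {{x, x \<otimes>\<^bsub>G\<^esub> s} | x s. x \<in> carrier G \<and> s \<in> S \<and> s \<noteq> \<one>\<^bsub>G\<^esub>}"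

abbreviation cayley_space :: "('a, 'b) monoid_scheme \<Rightarrow> 'a set \<Rightarrow> ('a \<Rightarrow> real) set" where
  "cayley_space G S \<equiv> realization (carrier G) (cayley_edges G S)"

abbreviation cayley_dist ::
    "('a, 'b) monoid_scheme \<Rightarrow> 'a set \<Rightarrow> ('a \<Rightarrow> real) \<Rightarrow> ('a \<Rightarrow> real) \<Rightarrow> real" where
  "cayley_dist G S \<equiv> realization_dist (cayley_edges G S)"

definition lacunary_hyperbolic :: "('a, 'b) monoid_scheme \<Rightarrow> bool" where
  "lacunary_hyperbolic G \<longleftrightarrow>
     group G \<and>
     (\<exists>S. finite S \<and> S \<subseteq> carrier G \<and> generate G S = carrier G \<and>
       (\<exists>\<omega> s e. nonprincipal_ultrafilter \<omega> \<and>
          (\<forall>n. 0 < s n) \<and> filterlim s at_top sequentially \<and>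
          (\<forall>n. e n \<in> cayley_space G S) \<and>
          real_tree (asymptotic_cone (cayley_space G S) (cayley_dist G S) \<omega> s e)
                    (cone_dist (cayley_dist G S) \<omega> s)))"

subsection \<open>Group-theoretic notions of the conclusion\<close>

definition EL :: "('a, 'b) monoid_scheme \<Rightarrow> 'a \<Rightarrow> 'a set" where
  "EL G g =
     {x \<in> carrier G. \<exists>n::nat. n > 0 \<and>
        (x \<otimes>\<^bsub>G\<^esub> g [^]\<^bsub>G\<^esub> n \<otimes>\<^bsub>G\<^esub> inv\<^bsub>G\<^esub> x = g [^]\<^bsub>G\<^esub> n \<or>
         x \<otimes>\<^bsub>G\<^esub> g [^]\<^bsub>G\<^esub> n \<otimes>\<^bsub>G\<^esub> inv\<^bsub>G\<^esub> x = g [^]\<^bsub>G\<^esub> (- int n))}"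

definition locally_finite :: "('a, 'b) monoid_scheme \<Rightarrow> bool" where
  "locally_finite H \<longleftrightarrow> (\<forall>F. finite F \<and> F \<subseteq> carrier H \<longrightarrow> finite (generate H F))"

definition rat_group :: "rat monoid" where
  "rat_group = \<lparr>carrier = UNIV, mult = (+), one = 0\<rparr>"

definition rank_one_abelian :: "('a, 'b) monoid_scheme \<Rightarrow> bool" where
  "rank_one_abelian H \<longleftrightarrow>
     group H \<and> carrier H \<noteq> {\<one>\<^bsub>H\<^esub>} \<and>
     (\<exists>K. subgroup K rat_group \<and> H \<cong> rat_group\<lparr>carrier := K\<rparr>)"

definition rank_one_by_inversion :: "('a, 'b) monoid_scheme \<Rightarrow> bool" where
  "rank_one_by_inversion Q \<longleftrightarrow>
     (\<exists>A. subgroup A Q \<and> card (rcosets\<^bsub>Q\<^esub> A) = 2 \<and> rank_one_abelian (Q\<lparr>carrier := A\<rparr>) \<and>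
        (\<forall>x\<in>carrier Q - A. \<forall>a\<in>A. x \<otimes>\<^bsub>Q\<^esub> a \<otimes>\<^bsub>Q\<^esub> inv\<^bsub>Q\<^esub> x = inv\<^bsub>Q\<^esub> a))"

end

theory Submission
  imports Defs
begin

text \<open>A real tree satisfies the four-point condition with error \<open>0\<close>. If one asymptotic cone of
  \<open>G\<close> is a real tree, then quadruples of vertices that violate an approximate four-point
  condition cannot occur at all large scales, since in the limit they would give four
  points of the cone that violate the exact one. Hence for every \<open>k\<close> there are arbitrarily
  large \<open>\<delta>\<close> such that the balls of radius \<open>k * \<delta>\<close> of the word metric satisfy the
  four-point condition with error \<open>\<delta>\<close> (\<open>hyperbolic_at_cone_scales\<close>). The rest of the
  geometry rests on this statement, on left invariance, and on the finiteness of balls.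

  The heart of the proof is \<open>finite_modulo_central_powers\<close>: if \<open>h\<close> has infinite order and
  the finite set \<open>S\<close> commutes with \<open>h\<close>, then finitely many cosets of \<open>\<langle>h\<rangle>\<close> cover \<open>\<langle>S\<rangle>\<close>. In
  a hyperbolic group this says that the centralizer of \<open>h\<close> is virtually cyclic. Here
  hyperbolicity is only local, and seen from the identity all powers of \<open>h\<close> in the visible
  ball may almost fix a common point, as those of a parabolic isometry do. The remedy is
  to move the basepoint. Write \<open>|k|\<^sub>p\<close> for the displacement \<open>d p (k p)\<close>. Among the points
  \<open>p\<close> that are displaced by at most \<open>8\<delta>\<close> by \<open>h\<close> and by \<open>S\<close>, choose one for which the
  number of powers of \<open>h\<close> with displacement at most \<open>40\<delta>\<close> is as large as possible; left
  invariance bounds this number by the size of a ball. Take the last power \<open>u\<close> of \<open>h\<close>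
  before \<open>40\<delta>\<close> is exceeded for the first time, and the midpoint \<open>m\<close> of \<open>p\<close> and \<open>u p\<close>. If
  \<open>u\<close> displaces \<open>m\<close> by at most \<open>5\<delta>\<close>, then \<open>u\<close> behaves like a rotation about \<open>m\<close>, and what
  commutes with \<open>u\<close> almost fixes \<open>m\<close> or displaces \<open>m\<close> much less than \<open>p\<close>
  (\<open>elliptic_displacement\<close>); so \<open>m\<close> is an admissible point with more powers than \<open>p\<close>, a
  contradiction. Otherwise \<open>u\<close> translates along the local axis through \<open>m\<close>
  (\<open>loxodromic_square\<close>). An element that commutes with \<open>u\<close> and carries \<open>m\<close> out of the
  \<open>2|u|\<^sub>m\<close>-neighbourhood of the orbit \<open>\<langle>u\<rangle> m\<close> must carry it far out
  (\<open>nearest_orbit_point\<close>), and one generator at a time cannot do this. So \<open>\<langle>S\<rangle> m\<close> stays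
  near \<open>\<langle>u\<rangle> m\<close>.

  The rest is algebra. The elements that commute with some positive power of \<open>g\<close> form a
  subgroup \<open>C\<close> of index at most \<open>2\<close> in \<open>EL G g\<close>. Every element of \<open>C\<close> satisfies \<open>x\<^sup>q =
  g\<^sup>p\<close> with \<open>q > 0\<close>, and \<open>slope g x = p / q\<close> is a homomorphism \<open>C \<rightarrow> \<rat>\<close>, because on
  finitely generated subgroups it is proportional to a transfer homomorphism into a cyclic
  central subgroup (\<open>transfer_to_central_powers\<close>). Its kernel \<open>N\<close> consists of the torsion
  elements of \<open>C\<close>, and a finitely generated subgroup of \<open>N\<close> is finite: for a suitable \<open>n\<close>
  it lies in finitely many cosets of \<open>\<langle>g\<^sup>n\<rangle>\<close>, and it meets each of them at most once.
  Elements of \<open>EL G g\<close> outside \<open>C\<close> invert slopes.\<close>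

section \<open>Real trees are 0-hyperbolic\<close>

definition geodesic_path ::
    "'a set \<Rightarrow> ('a \<Rightarrow> 'a \<Rightarrow> real) \<Rightarrow> 'a \<Rightarrow> 'a \<Rightarrow> (real \<Rightarrow> 'a) \<Rightarrow> bool" where
  "geodesic_path M d x y \<gamma> \<longleftrightarrow>
     \<gamma> \<in> {0..d x y} \<rightarrow> M \<and> \<gamma> 0 = x \<and> \<gamma> (d x y) = y \<and>
     (\<forall>t\<in>{0..d x y}. \<forall>u\<in>{0..d x y}. d (\<gamma> t) (\<gamma> u) = \<bar>t - u\<bar>)"

lemma geodesic_segment_iff_path:
  "geodesic_segment M d x y S \<longleftrightarrow> (\<exists>\<gamma>. geodesic_path M d x y \<gamma> \<and> S = \<gamma> ` {0..d x y})"
  unfolding geodesic_segment_def geodesic_path_def by auto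

locale real_tree_space =
  fixes M :: "'a set" and d :: "'a \<Rightarrow> 'a \<Rightarrow> real"
  assumes real_tree: "real_tree M d"
begin

lemma Metric: "Metric_space M (\<lambda>x y. if x \<in> M \<and> y \<in> M then d x y else 0)"
  using real_tree by (simp add: real_tree_def)

lemma dist_eq_0: "x \<in> M \<Longrightarrow> y \<in> M \<Longrightarrow> d x y = 0 \<longleftrightarrow> x = y"
  using Metric_space.zero[OF Metric, of x y] by simp

lemma dist_nonneg: "x \<in> M \<Longrightarrow> y \<in> M \<Longrightarrow> 0 \<le> d x y"
  using Metric_space.nonneg[OF Metric, of x y] by simp

lemma dist_sym: "x \<in> M \<Longrightarrow> y \<in> M \<Longrightarrow> d x y = d y x"
  using Metric_space.commute[OF Metric, of x y] by simp

lemma dist_tri: "x \<in> M \<Longrightarrow> y \<in> M \<Longrightarrow> z \<in> M \<Longrightarrow> d x z \<le> d x y + d y z"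
  using Metric_space.triangle[OF Metric, of x y z] by simp

lemma geodesic_exists:
  assumes "x \<in> M" "y \<in> M" obtains \<gamma> where "geodesic_path M d x y \<gamma>"
proof -
  have "\<exists>!S. geodesic_segment M d x y S" using real_tree assms by (simp add: real_tree_def)
  then show thesis using that unfolding geodesic_segment_iff_path by auto
qed

lemma segment_unique:
  assumes "x \<in> M" "y \<in> M" "geodesic_segment M d x y S" "geodesic_segment M d x y T"
  shows "S = T"
proof -
  have "\<exists>!S. geodesic_segment M d x y S" using real_tree assms by (simp add: real_tree_def)
  then show ?thesis using assms by blast
qed

lemma geodesic_isometric:
  assumes "geodesic_path M d x y \<gamma>" "0 \<le> s" "s \<le> d x y" "0 \<le> t" "t \<le> d x y"
  shows "d (\<gamma> s) (\<gamma> t) = \<bar>s - t\<bar>"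
  using assms by (simp add: geodesic_path_def)

lemma geodesic_on:
  assumes "geodesic_path M d x y \<gamma>" "0 \<le> t" "t \<le> d x y"
  shows "\<gamma> t \<in> M" "d x (\<gamma> t) = t" "d (\<gamma> t) y = d x y - t"
proof -
  have *: "\<And>t u. t \<in> {0..d x y} \<Longrightarrow> u \<in> {0..d x y} \<Longrightarrow> d (\<gamma> t) (\<gamma> u) = \<bar>t - u\<bar>"
    and e: "\<gamma> 0 = x" "\<gamma> (d x y) = y" and "\<gamma> \<in> {0..d x y} \<rightarrow> M"
    using assms(1) by (auto simp: geodesic_path_def)
  then show "\<gamma> t \<in> M" using assms by auto
  show "d x (\<gamma> t) = t" using *[of 0 t] e assms by auto
  show "d (\<gamma> t) y = d x y - t" using *[of t "d x y"] e assms by auto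
qed

lemma initial_segment:
  assumes "geodesic_path M d x y \<gamma>" "0 \<le> t" "t \<le> d x y"
  shows "geodesic_segment M d x (\<gamma> t) (\<gamma> ` {0..t})"
proof -
  have "geodesic_path M d x (\<gamma> t) \<gamma>"
    using assms geodesic_on(2)[OF assms] unfolding geodesic_path_def by auto
  then show ?thesis
    unfolding geodesic_segment_iff_path using geodesic_on(2)[OF assms] by (intro exI[of _ \<gamma>]) simp
qed

lemma final_segment:
  assumes "geodesic_path M d x y \<gamma>" "0 \<le> t" "t \<le> d x y"
  shows "geodesic_segment M d (\<gamma> t) y (\<gamma> ` {t..d x y})"
proof -
  let ?\<eta> = "\<lambda>s. \<gamma> (t + s)"
  have "geodesic_path M d (\<gamma> t) y ?\<eta>"
    using assms geodesic_on(3)[OF assms] unfolding geodesic_path_def by auto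
  moreover have "\<gamma> ` {t..d x y} = ?\<eta> ` {0..d (\<gamma> t) y}"
  proof
    show "\<gamma> ` {t..d x y} \<subseteq> ?\<eta> ` {0..d (\<gamma> t) y}"
    proof
      fix z assume "z \<in> \<gamma> ` {t..d x y}"
      then obtain r where "t \<le> r" "r \<le> d x y" "z = \<gamma> r" by auto
      then show "z \<in> ?\<eta> ` {0..d (\<gamma> t) y}"
        using geodesic_on(3)[OF assms] by (intro image_eqI[of _ _ "r - t"]) auto
    qed
  qed (use geodesic_on(3)[OF assms] assms(2) in auto)
  ultimately show ?thesis unfolding geodesic_segment_iff_path by blast
qed

lemma segment_reverse:
  assumes "x \<in> M" "y \<in> M" "geodesic_segment M d x y S"
  shows "geodesic_segment M d y x S"
proof -
  obtain \<gamma> where g: "geodesic_path M d x y \<gamma>" and S: "S = \<gamma> ` {0..d x y}"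
    using assms(3) unfolding geodesic_segment_iff_path by blast
  let ?\<eta> = "\<lambda>s. \<gamma> (d x y - s)"
  have e: "d y x = d x y" using assms dist_sym by simp
  have "geodesic_path M d y x ?\<eta>"
    using g dist_nonneg[OF assms(1,2)] unfolding geodesic_path_def e by auto
  moreover have "S = ?\<eta> ` {0..d y x}"
  proof
    show "S \<subseteq> ?\<eta> ` {0..d y x}"
    proof
      fix z assume "z \<in> S"
      then obtain r where "0 \<le> r" "r \<le> d x y" "z = \<gamma> r" by (auto simp: S)
      then show "z \<in> ?\<eta> ` {0..d y x}"
        using e by (intro image_eqI[of _ _ "d x y - r"]) auto
    qed
  qed (auto simp: S e)
  ultimately show ?thesis unfolding geodesic_segment_iff_path by blast
qed

lemma geodesics_agree_before:
  assumes g: "geodesic_path M d w x \<gamma>" and h: "geodesic_path M d w y \<eta>"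
    and t: "t \<le> d w x" "t \<le> d w y" "\<gamma> t = \<eta> t" and s: "0 \<le> s" "s \<le> t"
  shows "\<gamma> s = \<eta> s"
proof -
  have w: "w \<in> M" "\<gamma> t \<in> M"
    using geodesic_on(1)[OF g, of t] geodesic_on(1)[OF g, of 0] g t s by (auto simp: geodesic_path_def)
  have "\<gamma> ` {0..t} = \<eta> ` {0..t}"
    using segment_unique[OF w initial_segment[OF g]] initial_segment[OF h] t s by simp
  then obtain r where r: "0 \<le> r" "r \<le> t" "\<gamma> s = \<eta> r" using s by (metis (no_types, lifting) atLeastAtMost_iff image_iff)
  then have "s = r" using geodesic_on(2)[OF g, of s] geodesic_on(2)[OF h, of r] t s by simp
  then show ?thesis using r by simp
qed

text \<open>The number \<open>c\<close> is the Gromov product of \<open>x\<close> and \<open>y\<close> at \<open>w\<close>: two geodesics from \<open>w\<close>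
  coincide up to the last time at which they agree, and from there on they form a tripod,
  because their final segments meet only in the branch point and therefore concatenate.\<close>

lemma geodesics_branch:
  assumes c: "w \<in> M" "x \<in> M" "y \<in> M"
    and g: "geodesic_path M d w x \<gamma>" and h: "geodesic_path M d w y \<eta>"
  obtains c where "0 \<le> c" "c \<le> d w x" "c \<le> d w y" "d x y = d w x + d w y - 2 * c"
    "\<And>t. 0 \<le> t \<Longrightarrow> t \<le> c \<Longrightarrow> \<gamma> t = \<eta> t"
    "\<And>t. 0 \<le> t \<Longrightarrow> t \<le> d w x \<Longrightarrow> t \<le> d w y \<Longrightarrow> \<gamma> t = \<eta> t \<Longrightarrow> t \<le> c"
proof -
  define T where "T = {t. 0 \<le> t \<and> t \<le> d w x \<and> t \<le> d w y \<and> \<gamma> t = \<eta> t}"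
  define c where "c = Sup T"
  have T0: "0 \<in> T" using g h c dist_nonneg by (auto simp: T_def geodesic_path_def)
  have bdd: "bdd_above T" by (auto simp: T_def bdd_above_def)
  have up: "t \<le> c" if "t \<in> T" for t using that bdd by (simp add: c_def cSup_upper)
  have c0: "0 \<le> c" "c \<le> d w x" "c \<le> d w y"
    using up[OF T0] T0 by (auto simp: c_def T_def intro!: cSup_least)
  have M: "\<gamma> c \<in> M" "\<eta> c \<in> M" using geodesic_on(1) g h c0 by auto
  have "d (\<gamma> c) (\<eta> c) \<le> 0"
  proof (rule field_le_epsilon)
    fix e :: real assume "0 < e"
    then have "c - e / 2 < Sup T" by (simp add: c_def)
    then obtain t where t: "t \<in> T" "c - e / 2 < t"
      using less_cSup_iff[of T] bdd T0 by blast
    have tM: "\<gamma> t \<in> M" "\<gamma> t = \<eta> t" using geodesic_on(1)[OF g, of t] t(1) by (auto simp: T_def)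
    have "d (\<gamma> c) (\<gamma> t) = c - t" "d (\<eta> t) (\<eta> c) = c - t"
      using geodesic_isometric[OF g, of c t] geodesic_isometric[OF h, of t c] t up[OF t(1)] c0
      by (auto simp: T_def)
    then show "d (\<gamma> c) (\<eta> c) \<le> 0 + e"
      using dist_tri[of "\<gamma> c" "\<gamma> t" "\<eta> c"] M tM t by simp
  qed
  then have eq: "\<gamma> c = \<eta> c" using dist_eq_0 dist_nonneg M by (metis order_antisym)
  let ?p = "\<gamma> c"
  have xp: "geodesic_segment M d x ?p (\<gamma> ` {c..d w x})"
    using segment_reverse[OF M(1) c(2)] final_segment[OF g] c0 by simp
  have py: "geodesic_segment M d ?p y (\<eta> ` {c..d w y})"
    using final_segment[OF h] c0 eq by simp
  have "\<gamma> ` {c..d w x} \<inter> \<eta> ` {c..d w y} = {?p}"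
  proof
    show "{?p} \<subseteq> \<gamma> ` {c..d w x} \<inter> \<eta> ` {c..d w y}"
      using imageI[of c "{c..d w x}" \<gamma>] imageI[of c "{c..d w y}" \<eta>] eq c0 by simp
    show "\<gamma> ` {c..d w x} \<inter> \<eta> ` {c..d w y} \<subseteq> {?p}"
    proof
      fix z assume "z \<in> \<gamma> ` {c..d w x} \<inter> \<eta> ` {c..d w y}"
      then obtain a b where ab: "c \<le> a" "a \<le> d w x" "c \<le> b" "b \<le> d w y" "z = \<gamma> a" "z = \<eta> b" by auto
      then have "a = b" using geodesic_on(2)[OF g, of a] geodesic_on(2)[OF h, of b] c0 by simp
      then have "a \<in> T" using ab c0 by (auto simp: T_def)
      then have "a = c" using up ab by force
      then show "z \<in> {?p}" using ab by simp
    qed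
  qed
  then have "geodesic_segment M d x y (\<gamma> ` {c..d w x} \<union> \<eta> ` {c..d w y})"
    using real_tree xp py c M unfolding real_tree_def by blast
  then obtain \<sigma> where s: "geodesic_path M d x y \<sigma>"
    and im: "\<gamma> ` {c..d w x} \<union> \<eta> ` {c..d w y} = \<sigma> ` {0..d x y}"
    unfolding geodesic_segment_iff_path by blast
  have "?p \<in> \<sigma> ` {0..d x y}" using im c0 by auto
  then obtain r where "0 \<le> r" "r \<le> d x y" "?p = \<sigma> r" by auto
  then have "d x y = d x ?p + d ?p y" using geodesic_on[OF s, of r] by simp
  also have "d x ?p = d w x - c" using geodesic_on(3)[OF g c0(1,2)] dist_sym[OF c(2) M(1)] by simp
  also have "d ?p y = d w y - c" using geodesic_on(3)[OF h] c0 eq by simp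
  finally have "d x y = d w x + d w y - 2 * c" by simp
  moreover have "\<gamma> t = \<eta> t" if "0 \<le> t" "t \<le> c" for t
    using geodesics_agree_before[OF g h c0(2,3) eq that] .
  moreover have "t \<le> c" if "0 \<le> t" "t \<le> d w x" "t \<le> d w y" "\<gamma> t = \<eta> t" for t
    using up[of t] that by (simp add: T_def)
  ultimately show thesis using that[OF c0] by blast
qed

text \<open>By \<open>geodesics_branch\<close>, geodesics from \<open>w\<close> to two of the points agree exactly up to the
  Gromov product. Agreement at a given time is transitive, so of the three Gromov products
  at \<open>w\<close> each is at least the minimum of the other two; written out in distances, this is
  the four-point condition.\<close>

theorem four_point:
  assumes c: "x \<in> M" "y \<in> M" "z \<in> M" "w \<in> M"
  shows "d x y + d z w \<le> max (d x z + d y w) (d x w + d y z)"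
proof -
  obtain a b e where a: "geodesic_path M d w x a" and b: "geodesic_path M d w y b"
    and e: "geodesic_path M d w z e"
    using geodesic_exists c by metis
  obtain p where p: "0 \<le> p" "p \<le> d w x" "p \<le> d w z" "d x z = d w x + d w z - 2 * p"
    "\<And>t. 0 \<le> t \<Longrightarrow> t \<le> p \<Longrightarrow> a t = e t"
    by (rule geodesics_branch[OF c(4,1,3) a e]) blast
  obtain q where q: "0 \<le> q" "q \<le> d w z" "q \<le> d w y" "d z y = d w z + d w y - 2 * q"
    "\<And>t. 0 \<le> t \<Longrightarrow> t \<le> q \<Longrightarrow> e t = b t"
    by (rule geodesics_branch[OF c(4,3,2) e b]) blast
  obtain r where r: "d x y = d w x + d w y - 2 * r"
    "\<And>t. 0 \<le> t \<Longrightarrow> t \<le> d w x \<Longrightarrow> t \<le> d w y \<Longrightarrow> a t = b t \<Longrightarrow> t \<le> r"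
    by (rule geodesics_branch[OF c(4,1,2) a b]) blast
  have "min p q \<le> r"
    using p q by (intro r(2)) auto
  then show ?thesis using p(4) q(4) r(1) c dist_sym[of w y] dist_sym[of w z] dist_sym[of w x] dist_sym[of y z]
    by (auto simp: min_def max_def split: if_splits)
qed

end

section \<open>Commuting elements and powers\<close>

context group
begin

lemma mult_inv_cancel [simp]:
  assumes "a \<in> carrier G" "x \<in> carrier G"
  shows "a \<otimes> (inv a \<otimes> x) = x" "inv a \<otimes> (a \<otimes> x) = x"
  using assms by (simp_all add: m_assoc[symmetric])

lemma commutes_mult:
  assumes "x \<in> carrier G" "y \<in> carrier G" "u \<in> carrier G" "u \<otimes> x = x \<otimes> u" "u \<otimes> y = y \<otimes> u"
  shows "u \<otimes> (x \<otimes> y) = x \<otimes> y \<otimes> u"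
proof -
  have "u \<otimes> (x \<otimes> y) = u \<otimes> x \<otimes> y" using assms(1-3) by (simp add: m_assoc)
  also have "\<dots> = x \<otimes> u \<otimes> y" by (simp only: assms(4))
  also have "\<dots> = x \<otimes> (u \<otimes> y)" using assms(1-3) by (simp add: m_assoc)
  also have "u \<otimes> y = y \<otimes> u" by fact
  finally show ?thesis using assms(1-3) by (simp add: m_assoc)
qed

lemma commutes_inv:
  assumes "x \<in> carrier G" "u \<in> carrier G" "u \<otimes> x = x \<otimes> u"
  shows "u \<otimes> inv x = inv x \<otimes> u"
proof -
  have "u \<otimes> inv x = inv x \<otimes> (x \<otimes> u) \<otimes> inv x" using assms by simp
  also have "x \<otimes> u = u \<otimes> x" using assms by simp
  finally show ?thesis using assms(1,2) by (simp add: m_assoc)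
qed

lemma commutes_pow:
  assumes "x \<in> carrier G" "h \<in> carrier G" "x \<otimes> h = h \<otimes> x"
  shows "x \<otimes> h [^] (j::int) = h [^] j \<otimes> x"
proof -
  have n: "x \<otimes> h [^] (n::nat) = h [^] n \<otimes> x" for n
    by (induct n) (use assms commutes_mult in simp_all)
  have inv: "x \<otimes> inv (h [^] n) = inv (h [^] n) \<otimes> x" for n :: nat
    by (rule commutes_inv[OF _ assms(1) n]) (simp add: assms(2))
  show ?thesis
  proof (cases j rule: int_cases2)
    case (nonneg k)
    then show ?thesis using n[of k] by (simp only: int_pow_int)
  next
    case (nonpos k)
    then show ?thesis using inv[of k] assms(2) by (simp only: int_pow_neg_int)
  qed
qed

lemma inj_int_pow:
  assumes h: "h \<in> carrier G" "\<And>n::nat. n > 0 \<Longrightarrow> h [^] n \<noteq> \<one>"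
  shows "inj (\<lambda>j::int. h [^] j)"
proof -
  have *: "\<not> i < j" if e: "h [^] i = h [^] j" for i j :: int
  proof
    assume "i < j"
    have "h [^] (j - i) = \<one>" using e h by (simp add: int_pow_diff)
    then show False using h(2)[of "nat (j - i)"] \<open>i < j\<close> by simp
  qed
  show ?thesis
    by (rule injI) (use * in \<open>metis linorder_neqE\<close>)
qed

end

section \<open>Groups that are hyperbolic at arbitrarily large scales\<close>

text \<open>Natural numbers as distances and as error keep the estimates below within linear
  arithmetic over \<open>nat\<close>.\<close>

definition four_point_in_balls :: "'p set \<Rightarrow> ('p \<Rightarrow> 'p \<Rightarrow> nat) \<Rightarrow> nat \<Rightarrow> nat \<Rightarrow> bool" where
  "four_point_in_balls X d r \<delta> \<longleftrightarrow>
     (\<forall>b\<in>X. \<forall>x\<in>X. \<forall>y\<in>X. \<forall>z\<in>X. \<forall>w\<in>X.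
        d b x \<le> r \<longrightarrow> d b y \<le> r \<longrightarrow> d b z \<le> r \<longrightarrow> d b w \<le> r \<longrightarrow>
        d x y + d z w \<le> max (d x z + d y w) (d x w + d y z) + \<delta>)"

text \<open>The last assumption is the trace that a tree-like asymptotic cone leaves in the group:
  the ratio \<open>k\<close> between the radius and the error is at our disposal, but not the scale \<open>\<delta>\<close>
  itself.\<close>

locale locally_hyperbolic_group = group G for G (structure) +
  fixes d :: "'a \<Rightarrow> 'a \<Rightarrow> nat"
  assumes dist_self: "x \<in> carrier G \<Longrightarrow> d x x = 0"
    and dist_commute: "x \<in> carrier G \<Longrightarrow> y \<in> carrier G \<Longrightarrow> d x y = d y x"
    and dist_triangle: "x \<in> carrier G \<Longrightarrow> y \<in> carrier G \<Longrightarrow> z \<in> carrier G \<Longrightarrow> d x z \<le> d x y + d y z"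
    and dist_left: "a \<in> carrier G \<Longrightarrow> x \<in> carrier G \<Longrightarrow> y \<in> carrier G \<Longrightarrow> d (a \<otimes> x) (a \<otimes> y) = d x y"
    and midpoint: "x \<in> carrier G \<Longrightarrow> y \<in> carrier G \<Longrightarrow>
      \<exists>m\<in>carrier G. 2 * d x m \<le> d x y + 1 \<and> 2 * d m y \<le> d x y + 1"
    and finite_ball: "finite {x \<in> carrier G. d \<one> x \<le> r}"
    and hyperbolic_scales: "\<exists>\<delta>\<ge>c. four_point_in_balls (carrier G) d (k * \<delta>) \<delta>"
begin

lemma four_point:
  assumes "four_point_in_balls (carrier G) d r \<delta>"
    and "b \<in> carrier G" "x \<in> carrier G" "y \<in> carrier G" "z \<in> carrier G" "w \<in> carrier G"
    and "d b x \<le> r" "d b y \<le> r" "d b z \<le> r" "d b w \<le> r"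
  shows "d x y + d z w \<le> d x z + d y w + \<delta> \<or> d x y + d z w \<le> d x w + d y z + \<delta>"
proof -
  have "d x y + d z w \<le> max (d x z + d y w) (d x w + d y z) + \<delta>"
    using assms by (simp add: four_point_in_balls_def)
  then show ?thesis by linarith
qed

text \<open>In a tree, let \<open>u\<close> fix the midpoint \<open>m\<close> of \<open>p\<close> and \<open>u p\<close>. Then \<open>u\<close> turns the direction
  of \<open>p\<close> at \<open>m\<close> into a different one, while it fixes the path from \<open>m\<close> to \<open>v m\<close> for each
  \<open>v\<close> commuting with \<open>u\<close>. So the path from \<open>p\<close> to \<open>v p\<close> runs through \<open>m\<close> and \<open>v m\<close>: either
  \<open>v m\<close> equals \<open>m\<close>, or \<open>v\<close> displaces \<open>p\<close> by \<open>d p (u p) + d m (v m)\<close>. The lemma is the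
  coarse form of this alternative.\<close>

lemma elliptic_displacement:
  assumes fp: "four_point_in_balls (carrier G) d r \<delta>"
    and c: "p \<in> carrier G" "m \<in> carrier G" "u \<in> carrier G" "v \<in> carrier G"
    and comm: "u \<otimes> v = v \<otimes> u"
    and mid: "2 * d p m \<le> d p (u \<otimes> p) + 1" "2 * d m (u \<otimes> p) \<le> d p (u \<otimes> p) + 1"
    and r: "2 * d p (u \<otimes> p) + d p (v \<otimes> p) + 2 \<le> r" and \<delta>: "1 \<le> \<delta>"
  shows "d m (v \<otimes> m) \<le> d m (u \<otimes> m) + 3 * \<delta> \<or>
    d p (u \<otimes> p) + d m (v \<otimes> m) \<le> d p (v \<otimes> p) + 2 * d m (u \<otimes> m) + 4 * \<delta>"
proof -
  define up um vp vm vup where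
    defs: "up = u \<otimes> p" "um = u \<otimes> m" "vp = v \<otimes> p" "vm = v \<otimes> m" "vup = v \<otimes> (u \<otimes> p)"
  have cc: "up \<in> carrier G" "um \<in> carrier G" "vp \<in> carrier G" "vm \<in> carrier G" "vup \<in> carrier G"
    using c by (auto simp: defs)
  have sw: "v \<otimes> (u \<otimes> x) = u \<otimes> (v \<otimes> x)" if "x \<in> carrier G" for x
    using that c comm by (simp add: m_assoc[symmetric])
  have e: "d vp vup = d p up" "d vp vm = d p m" "d vm vup = d m up"
    using c by (auto simp: defs dist_left)
  have t1: "d up vm \<le> d p vm + d m um"
  proof -
    have "d up vm \<le> d up (u \<otimes> vm) + d (u \<otimes> vm) vm"
      using c cc by (intro dist_triangle) auto
    also have "d up (u \<otimes> vm) = d p vm" using c cc by (simp add: dist_left defs)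
    also have "d (u \<otimes> vm) vm = d um m" using c by (simp add: defs sw[symmetric] dist_left)
    finally show ?thesis using c cc by (simp add: dist_commute)
  qed
  have t2: "d m vup \<le> d m um + d m vp"
  proof -
    have "d m vup \<le> d m um + d um vup" using c cc by (intro dist_triangle) auto
    also have "d um vup = d m vp" using c by (simp add: defs sw dist_left)
    finally show ?thesis .
  qed
  note tri = dist_triangle and sym = dist_commute
  have s: "d m p = d p m" "d vm m = d m vm" "d vm vp = d vp vm" "d vm p = d p vm" "d vm up = d up vm"
    "d vp m = d m vp" "d up m = d m up"
    using c cc by (auto intro: sym)
  have b1: "d m vp \<le> d p m + d p vp" using tri[of m p vp] c cc s by auto
  have b2: "d m vm \<le> d m vp + d vp vm" using tri c cc by auto
  have b3: "d m vup \<le> d m vm + d m up" using tri[of m vm vup] c cc e by auto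
  have m: "2 * d p m \<le> d p up + 1" "2 * d m up \<le> d p up + 1" "2 * d p up + d p vp + 2 \<le> r"
    using mid r by (auto simp: defs)
  have "d m vm + d p up \<le> d m p + d vm up + \<delta> \<or> d m vm + d p up \<le> d m up + d vm p + \<delta>"
    by (rule four_point[OF fp, of m]) (use c cc b1 b2 b3 m e s dist_self in auto)
  then have f1: "2 * d p vm + 2 * d m um + 2 * \<delta> + 1 \<ge> d p up + 2 * d m vm"
    using t1 m s by linarith
  have "d vm m + d vp vup \<le> d vm vp + d m vup + \<delta> \<or> d vm m + d vp vup \<le> d vm vup + d m vp + \<delta>"
    by (rule four_point[OF fp, of m]) (use c cc b1 b2 b3 m e s dist_self in auto)
  then have f2: "2 * d m vp + 2 * d m um + 2 * \<delta> + 1 \<ge> d p up + 2 * d m vm"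
    using t2 m s e by linarith
  have "d p vm + d m vp \<le> d p m + d vm vp + \<delta> \<or> d p vm + d m vp \<le> d p vp + d vm m + \<delta>"
    by (rule four_point[OF fp, of m]) (use c cc b1 b2 b3 m e s dist_self in auto)
  then have "d m vm \<le> d m um + 3 * \<delta> \<or> d p up + d m vm \<le> d p vp + 2 * d m um + 4 * \<delta>"
    using f1 f2 m s e \<delta> by linarith
  then show ?thesis by (simp add: defs)
qed

text \<open>Two steps of \<open>u\<close> from \<open>m\<close> hardly backtrack: seen from \<open>m\<close>, the point \<open>u m\<close> lies in the
  direction of \<open>u p\<close> and the point \<open>inv u m\<close> in the direction of \<open>p\<close>, and these directions
  are opposite.\<close>

lemma loxodromic_square:
  assumes fp: "four_point_in_balls (carrier G) d r \<delta>"
    and c: "p \<in> carrier G" "m \<in> carrier G" "u \<in> carrier G"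
    and mid: "2 * d p m \<le> d p (u \<otimes> p) + 1" "2 * d m (u \<otimes> p) \<le> d p (u \<otimes> p) + 1"
    and r: "d p (u \<otimes> p) + 1 \<le> r" and t: "2 * \<delta> + 1 < d m (u \<otimes> m)"
  shows "2 * d m (u \<otimes> m) \<le> d m (u \<otimes> (u \<otimes> m)) + 2 * \<delta> + 1"
proof -
  define up um wm where defs: "up = u \<otimes> p" "um = u \<otimes> m" "wm = inv u \<otimes> m"
  have cc: "up \<in> carrier G" "um \<in> carrier G" "wm \<in> carrier G"
    using c by (auto simp: defs)
  have uwm: "u \<otimes> wm = m" using c by (simp add: defs m_assoc[symmetric])
  have e: "d up um = d p m" "d wm p = d m up" "d wm m = d m um"
    using dist_left[of u p m] dist_left[of u wm p] dist_left[of u wm m] c cc uwm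
    by (auto simp: defs)
  have e2: "d m (u \<otimes> um) = d wm um"
    using dist_left[of u wm um] c cc uwm by simp
  have s: "d m p = d p m" "d um m = d m um" "d m wm = d wm m" "d p wm = d wm p" "d up wm = d wm up"
     "d up m = d m up" "d um up = d up um"
    using c cc by (auto intro: dist_commute)
  have b: "d m um \<le> d m up + d up um" using dist_triangle c cc by auto
  have m: "2 * d p m \<le> d p up + 1" "2 * d m up \<le> d p up + 1" "d p up + 1 \<le> r"
    using mid r by (auto simp: defs)
  have "d p up + d wm m \<le> d p wm + d up m + \<delta> \<or> d p up + d wm m \<le> d p m + d up wm + \<delta>"
    by (rule four_point[OF fp, of m]) (use c cc b m e s dist_self in auto)
  moreover have "d wm up + d um m \<le> d wm um + d up m + \<delta> \<or> d wm up + d um m \<le> d wm m + d up um + \<delta>"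
    by (rule four_point[OF fp, of m]) (use c cc b m e s dist_self in auto)
  ultimately have "2 * d m um \<le> d wm um + 2 * \<delta> + 1"
    using m e s t b unfolding defs(2)[symmetric] by linarith
  then show ?thesis using e2 unfolding defs by linarith
qed

text \<open>If \<open>y m\<close> were far from the orbit of \<open>m\<close> under \<open>u\<close>, then \<open>m\<close>, \<open>u m\<close> and \<open>u (u m)\<close> would
  all have almost the same distance to it. But the middle one of three points on a local
  geodesic is closer to a distant point than one of the outer two, by almost a translation
  length.\<close>

lemma nearest_orbit_point:
  assumes fp: "four_point_in_balls (carrier G) d r \<delta>"
    and c: "m \<in> carrier G" "u \<in> carrier G" "y \<in> carrier G"
    and comm: "u \<otimes> y = y \<otimes> u"
    and sq: "2 * d m (u \<otimes> m) \<le> d m (u \<otimes> (u \<otimes> m)) + 2 * \<delta> + 1"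
    and t: "4 * \<delta> + 1 < d m (u \<otimes> m)"
    and near: "\<And>j::int. d m (y \<otimes> m) \<le> d (u [^] j \<otimes> m) (y \<otimes> m)"
    and r: "2 * d m (u \<otimes> m) + d m (y \<otimes> m) \<le> r"
  shows "d m (y \<otimes> m) \<le> 2 * d m (u \<otimes> m)"
proof (rule ccontr)
  assume far: "\<not> ?thesis"
  define um uum x uux where defs: "um = u \<otimes> m" "uum = u \<otimes> (u \<otimes> m)" "x = y \<otimes> m" "uux = u \<otimes> (u \<otimes> x)"
  have cc: "um \<in> carrier G" "uum \<in> carrier G" "x \<in> carrier G" "uux \<in> carrier G"
    using c by (auto simp: defs)
  have "uux = y \<otimes> uum"
    using c comm by (simp add: defs m_assoc[symmetric])
  then have e: "d x uux = d m uum" using c by (simp add: defs dist_left)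
  have e': "d um uum = d m um" "d uum uux = d m x"
    using c by (auto simp: defs dist_left)
  note e = e e'
  have n1: "d m x \<le> d um x" using near[of 1] c by (simp add: defs)
  \<comment> \<open>The point \<open>y m\<close> is also nearest to \<open>m\<close> on its own orbit, because \<open>u\<close> commutes
    with \<open>y\<close>.\<close>
  have p2: "u [^] (-2::int) = inv u \<otimes> inv u"
    using int_pow_mult[OF c(2), of "-1" "-1"] c by (simp add: int_pow_neg)
  have "d m x \<le> d (inv u \<otimes> inv u \<otimes> m) x" using near[of "-2"] p2 by (simp add: defs)
  also have "\<dots> = d (u \<otimes> (u \<otimes> (inv u \<otimes> inv u \<otimes> m))) uux"
    using c cc by (simp add: dist_left defs)
  also have "u \<otimes> (u \<otimes> (inv u \<otimes> inv u \<otimes> m)) = m"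
    using c by (simp add: m_assoc)
  finally have n2: "d m x \<le> d m uux" .
  have s: "d x um = d um x" "d x m = d m x" "d uux x = d x uux" "d uum x = d x uum" "d um m = d m um"
    "d uum m = d m uum" "d x uum = d uum x" "d uum um = d um uum"
    using c cc by (auto intro: dist_commute)
  have b: "d m uum \<le> 2 * d m um" using dist_triangle[of m um uum] c cc e by auto
  have b2: "d m uux \<le> d m x + d m uum" using dist_triangle[of m x uux] c cc e by auto
  have rr: "2 * d m um + d m x \<le> r" "4 * \<delta> + 1 < d m um" "2 * d m um < d m x" "2 * d m um \<le> d m uum + 2 * \<delta> + 1"
    using r far t sq by (auto simp: defs)
  have "d m uux + d x uum \<le> d m x + d uux uum + \<delta> \<or> d m uux + d x uum \<le> d m uum + d uux x + \<delta>"
    by (rule four_point[OF fp, of m]) (use c cc b b2 rr e s dist_self in auto)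
  moreover have "d uux uum = d m x" using e cc dist_commute by metis
  ultimately have 2: "d x uum \<le> d m x + \<delta>" using n2 s e b rr by linarith
  have "d x um + d m uum \<le> d x m + d um uum + \<delta> \<or> d x um + d m uum \<le> d x uum + d um m + \<delta>"
    by (rule four_point[OF fp, of m]) (use c cc b b2 rr e s dist_self in auto)
  then show False using 2 n1 rr e s by linarith
qed

text \<open>The bound does not depend on \<open>p\<close>, because conjugation by \<open>p\<close> takes the displacement at
  \<open>p\<close> to the displacement at \<open>\<one>\<close>. It makes the count of powers of \<open>h\<close> in
  \<open>finite_modulo_central_powers\<close> attain its maximum.\<close>

lemma displacement_ball:
  assumes p: "p \<in> carrier G"
  shows "finite {z \<in> carrier G. d p (z \<otimes> p) \<le> r}"
    and "card {z \<in> carrier G. d p (z \<otimes> p) \<le> r} \<le> card {x \<in> carrier G. d \<one> x \<le> r}"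
proof -
  let ?A = "{z \<in> carrier G. d p (z \<otimes> p) \<le> r}" and ?B = "{x \<in> carrier G. d \<one> x \<le> r}"
  have inj: "inj_on (\<lambda>z. inv p \<otimes> (z \<otimes> p)) ?A"
    using p by (auto simp: inj_on_def)
  have "d \<one> (inv p \<otimes> (z \<otimes> p)) = d p (z \<otimes> p)" if "z \<in> carrier G" for z
    using dist_left[of p \<one> "inv p \<otimes> (z \<otimes> p)"] that p by simp
  then have im: "(\<lambda>z. inv p \<otimes> (z \<otimes> p)) ` ?A \<subseteq> ?B"
    using p by auto
  show "finite ?A" using inj im finite_ball by (rule inj_on_finite)
  show "card ?A \<le> card ?B" using inj im finite_ball by (rule card_inj_on_le)
qed

lemma displacement_mult:
  assumes "x \<in> carrier G" "y \<in> carrier G" "p \<in> carrier G"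
  shows "d p (x \<otimes> y \<otimes> p) \<le> d p (x \<otimes> p) + d p (y \<otimes> p)"
  using dist_triangle[of p "x \<otimes> p" "x \<otimes> (y \<otimes> p)"] assms by (simp add: dist_left m_assoc)

lemma displacement_inv:
  assumes "x \<in> carrier G" "p \<in> carrier G"
  shows "d p (inv x \<otimes> p) = d p (x \<otimes> p)"
  using dist_left[of x p "inv x \<otimes> p"] dist_commute[of "x \<otimes> p" p] assms by simp

lemma displacement_move:
  assumes "x \<in> carrier G" "p \<in> carrier G" "m \<in> carrier G"
  shows "d m (x \<otimes> m) \<le> 2 * d p m + d p (x \<otimes> p)"
proof -
  have "d m (x \<otimes> m) \<le> d m p + d p (x \<otimes> m)" using assms by (intro dist_triangle) auto
  also have "d p (x \<otimes> m) \<le> d p (x \<otimes> p) + d (x \<otimes> p) (x \<otimes> m)" using assms by (intro dist_triangle) auto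
  finally show ?thesis using assms by (simp add: dist_left dist_commute)
qed

text \<open>A generator \<open>s\<close> moves \<open>y m\<close> out of the neighbourhood of the orbit by a controlled amount
  only. That leaves the nearest orbit point within reach of \<open>nearest_orbit_point\<close>, which
  pulls the point back into the neighbourhood. So a local hypothesis suffices for
  arbitrarily long words.\<close>

lemma orbit_neighbourhood_invariant:
  assumes fp: "four_point_in_balls (carrier G) d r \<delta>"
    and c: "m \<in> carrier G" "u \<in> carrier G" "y \<in> carrier G" "s \<in> carrier G"
    and comm: "u \<otimes> y = y \<otimes> u" "u \<otimes> s = s \<otimes> u"
    and sq: "2 * d m (u \<otimes> m) \<le> d m (u \<otimes> (u \<otimes> m)) + 2 * \<delta> + 1"
    and t: "4 * \<delta> + 1 < d m (u \<otimes> m)"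
    and r: "4 * d m (u \<otimes> m) + d m (s \<otimes> m) \<le> r"
    and y: "\<exists>j::int. d (u [^] j \<otimes> m) (y \<otimes> m) \<le> 2 * d m (u \<otimes> m)"
  shows "\<exists>j::int. d (u [^] j \<otimes> m) (s \<otimes> y \<otimes> m) \<le> 2 * d m (u \<otimes> m)"
proof -
  obtain k :: int where k: "d (u [^] k \<otimes> m) (y \<otimes> m) \<le> 2 * d m (u \<otimes> m)" using y by blast
  obtain j :: int where j: "\<And>i::int. d (u [^] j \<otimes> m) (s \<otimes> y \<otimes> m) \<le> d (u [^] i \<otimes> m) (s \<otimes> y \<otimes> m)"
    using ex_has_least_nat[of "\<lambda>_. True" undefined "\<lambda>i::int. d (u [^] i \<otimes> m) (s \<otimes> y \<otimes> m)"] by blast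
  \<comment> \<open>Translating by \<open>u [^] (- j)\<close> makes \<open>m\<close> itself the nearest orbit point.\<close>
  define w where "w = u [^] (- j) \<otimes> (s \<otimes> y)"
  have w: "w \<in> carrier G" using c by (simp add: w_def)
  have shift: "d (u [^] i \<otimes> m) (w \<otimes> m) = d (u [^] (j + i) \<otimes> m) (s \<otimes> y \<otimes> m)" for i :: int
  proof -
    have "d (u [^] i \<otimes> m) (w \<otimes> m) = d (u [^] j \<otimes> (u [^] i \<otimes> m)) (u [^] j \<otimes> (w \<otimes> m))"
      using c w by (simp add: dist_left)
    also have "u [^] j \<otimes> (u [^] i \<otimes> m) = u [^] (j + i) \<otimes> m"
      using c by (simp add: int_pow_mult m_assoc)
    also have "u [^] j \<otimes> (w \<otimes> m) = s \<otimes> y \<otimes> m"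
      using c by (simp add: w_def int_pow_neg m_assoc)
    finally show ?thesis .
  qed
  have cu: "u \<otimes> w = w \<otimes> u"
  proof -
    have "u \<otimes> w = u [^] (- j) \<otimes> (u \<otimes> (s \<otimes> y))"
      using commutes_pow[of u u "- j"] c by (simp add: w_def m_assoc[symmetric])
    also have "u \<otimes> (s \<otimes> y) = s \<otimes> y \<otimes> u" using comm c by (intro commutes_mult) auto
    finally show ?thesis using c by (simp add: w_def m_assoc)
  qed
  have "d m (w \<otimes> m) = d (u [^] j \<otimes> m) (s \<otimes> y \<otimes> m)" using shift[of 0] c by simp
  also have "\<dots> \<le> d (u [^] k \<otimes> m) (s \<otimes> y \<otimes> m)" by (rule j)
  also have "\<dots> \<le> d (u [^] k \<otimes> m) (s \<otimes> (u [^] k \<otimes> m)) + d (s \<otimes> (u [^] k \<otimes> m)) (s \<otimes> y \<otimes> m)"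
    using c by (intro dist_triangle) auto
  also have "d (s \<otimes> (u [^] k \<otimes> m)) (s \<otimes> y \<otimes> m) = d (u [^] k \<otimes> m) (y \<otimes> m)"
    using c by (simp add: m_assoc dist_left)
  also have "s \<otimes> (u [^] k \<otimes> m) = u [^] k \<otimes> (s \<otimes> m)"
    using commutes_pow[of s u k] comm c by (simp add: m_assoc[symmetric])
  also have "d (u [^] k \<otimes> m) (u [^] k \<otimes> (s \<otimes> m)) = d m (s \<otimes> m)"
    using c by (simp add: dist_left)
  finally have far: "d m (w \<otimes> m) \<le> d m (s \<otimes> m) + 2 * d m (u \<otimes> m)" using k by linarith
  have "d m (w \<otimes> m) \<le> 2 * d m (u \<otimes> m)"
  proof (rule nearest_orbit_point[OF fp c(1,2) w cu sq t])
    show "d m (w \<otimes> m) \<le> d (u [^] i \<otimes> m) (w \<otimes> m)" for i :: int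
      using shift[of 0] shift[of i] j[of "j + i"] c by simp
    show "2 * d m (u \<otimes> m) + d m (w \<otimes> m) \<le> r" using far r by linarith
  qed
  then show ?thesis using shift[of 0] c by auto
qed

text \<open>The constants: \<open>8\<delta>\<close> absorbs the bound \<open>5\<delta> + 3\<delta>\<close> of \<open>elliptic_displacement\<close>, and \<open>40\<delta>\<close>
  exceeds \<open>2 * 8\<delta> + 14\<delta>\<close>, which excludes its second alternative for generators. All points
  to which the four-point condition is applied lie within \<open>400\<delta>\<close> of \<open>m\<close>.\<close>

theorem finite_modulo_central_powers:
  assumes h: "h \<in> carrier G" "\<And>n::nat. n > 0 \<Longrightarrow> h [^] n \<noteq> \<one>"
    and S: "finite S" "S \<subseteq> carrier G" "\<And>s. s \<in> S \<Longrightarrow> s \<otimes> h = h \<otimes> s"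
  shows "\<exists>F\<subseteq>carrier G. finite F \<and> (\<forall>y\<in>generate G S. \<exists>j::int. \<exists>z\<in>F. y = h [^] j \<otimes> z)"
proof -
  \<comment> \<open>\<open>h\<close> itself must have small displacement at the chosen point, so that the
    displacement of its powers grows in small steps.\<close>
  define T where "T = insert h S"
  have T: "finite T" "T \<subseteq> carrier G" "h \<in> T"
    using S(1,2) h(1) by (auto simp: T_def)
  have comm: "s \<otimes> h = h \<otimes> s" if "s \<in> T" for s
    using that S(3) unfolding T_def by blast
  obtain \<delta> where \<delta>: "Suc (Max (d \<one> ` T)) \<le> \<delta>"
    and fp: "four_point_in_balls (carrier G) d (400 * \<delta>) \<delta>"
    using hyperbolic_scales by blast
  have \<delta>1: "1 \<le> \<delta>" using \<delta> by simp
  define P where "P p \<longleftrightarrow> p \<in> carrier G \<and> (\<forall>s\<in>T. d p (s \<otimes> p) \<le> 8 * \<delta>)" for p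
  define I where "I p = {i::int. d p (h [^] i \<otimes> p) \<le> 40 * \<delta>}" for p
  have P1: "P \<one>"
  proof -
    have "d \<one> s \<le> 8 * \<delta>" if "s \<in> T" for s
    proof -
      have "d \<one> s \<le> Max (d \<one> ` T)" using that T by simp
      then show ?thesis using \<delta> by linarith
    qed
    then show ?thesis using T by (auto simp: P_def subset_eq)
  qed
  have injh: "inj (\<lambda>i::int. h [^] i)" using h by (rule inj_int_pow)
  have fin: "finite (I p)" and bound: "card (I p) \<le> card {x \<in> carrier G. d \<one> x \<le> 40 * \<delta>}"
    if "p \<in> carrier G" for p
  proof -
    let ?A = "{z \<in> carrier G. d p (z \<otimes> p) \<le> 40 * \<delta>}"
    have inj: "inj_on (\<lambda>i::int. h [^] i) (I p)" using injh by (rule inj_on_subset) simp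
    have sub: "(\<lambda>i::int. h [^] i) ` I p \<subseteq> ?A" using h by (auto simp: I_def)
    note fA = displacement_ball[OF that, of "40 * \<delta>"]
    show "finite (I p)" using inj sub fA(1) by (rule inj_on_finite)
    show "card (I p) \<le> card {x \<in> carrier G. d \<one> x \<le> 40 * \<delta>}"
      using card_inj_on_le[OF inj sub fA(1)] fA(2) by linarith
  qed
  obtain p where Pp: "P p" and max: "\<And>q. P q \<Longrightarrow> card (I q) \<le> card (I p)"
    using ex_has_greatest_nat[of P \<one> "\<lambda>p. card (I p)" "Suc (card {x \<in> carrier G. d \<one> x \<le> 40 * \<delta>})"]
      P1 bound by (auto simp: P_def less_Suc_eq_le)
  have p: "p \<in> carrier G" and sp: "\<And>s. s \<in> T \<Longrightarrow> d p (s \<otimes> p) \<le> 8 * \<delta>" using Pp by (auto simp: P_def)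
  have "\<exists>n::nat. 40 * \<delta> < d p (h [^] n \<otimes> p)"
  proof (rule ccontr)
    assume "\<not> ?thesis"
    then have "range int \<subseteq> I p" by (auto simp: I_def int_pow_int not_less)
    then have "finite (range int)" using fin[OF p] by (rule finite_subset)
    then show False using finite_imageD[of int UNIV] by simp
  qed
  then obtain n :: nat where n: "40 * \<delta> < d p (h [^] n \<otimes> p)"
    and before: "\<And>i. i < n \<Longrightarrow> d p (h [^] i \<otimes> p) \<le> 40 * \<delta>"
    using exists_least_iff[of "\<lambda>n::nat. 40 * \<delta> < d p (h [^] n \<otimes> p)"] by (auto simp only: not_less)
  have "n \<noteq> 0" using n p by (auto simp: dist_self intro!: Nat.gr0I)
  then obtain i where i: "n = Suc i" by (cases n) auto
  define u where "u = h [^] i"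
  have u: "u \<in> carrier G" using h by (simp add: u_def)
  have uj: "u [^] j = h [^] (int i * j)" for j :: int
    using h by (simp add: u_def int_pow_pow int_pow_int[symmetric])
  have hu: "h \<otimes> u = h [^] n" using h commutes_pow[of h h "int i"] by (simp add: u_def i int_pow_int)
  have L: "d p (u \<otimes> p) \<le> 40 * \<delta>" using before[of i] i by (simp add: u_def)
  have L': "32 * \<delta> < d p (u \<otimes> p)"
    using displacement_mult[OF h(1) u p] n sp[OF T(3)] by (simp add: hu)
  obtain m where m: "m \<in> carrier G" and mid: "2 * d p m \<le> d p (u \<otimes> p) + 1" "2 * d m (u \<otimes> p) \<le> d p (u \<otimes> p) + 1"
    using midpoint[of p "u \<otimes> p"] p u by auto
  have commu: "u \<otimes> x = x \<otimes> u" if "x \<in> carrier G" "x \<otimes> h = h \<otimes> x" for x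
    using commutes_pow[OF that(1) h(1) that(2), of "int i"] by (simp add: u_def int_pow_int)
  show ?thesis
  proof (cases "d m (u \<otimes> m) \<le> 5 * \<delta>")
    case True
    have ell: "d m (v \<otimes> m) \<le> 8 * \<delta> \<or> d p (u \<otimes> p) + d m (v \<otimes> m) \<le> d p (v \<otimes> p) + 14 * \<delta>"
      if v: "v \<in> carrier G" "v \<otimes> h = h \<otimes> v" and dv: "d p (v \<otimes> p) \<le> 40 * \<delta>" for v
    proof -
      have "2 * d p (u \<otimes> p) + d p (v \<otimes> p) + 2 \<le> 400 * \<delta>" using L dv \<delta>1 by linarith
      from elliptic_displacement[OF fp p m u v(1) commu[OF v] mid this \<delta>1]
      show ?thesis using True by linarith
    qed
    have sm: "d m (s \<otimes> m) \<le> 8 * \<delta>" if "s \<in> T" for s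
      using ell[of s, OF _ comm[OF that]] sp[OF that] that T(2) L' by force
    then have "P m" using m by (simp add: P_def)
    have hc: "h [^] j \<otimes> h = h \<otimes> h [^] j" for j :: int using commutes_pow[of h h j] h(1) by simp
    have sub: "I p \<subseteq> I m"
    proof
      fix j assume "j \<in> I p"
      then have "d p (h [^] j \<otimes> p) \<le> 40 * \<delta>" by (simp add: I_def)
      then show "j \<in> I m" using ell[of "h [^] j", OF _ hc] h(1) L' by (force simp: I_def)
    qed
    \<comment> \<open>The power after \<open>u\<close> is too long at \<open>p\<close>, but short at \<open>m\<close>, where both \<open>u\<close> and \<open>h\<close>
      are.\<close>
    have "int n \<in> I m"
      using displacement_mult[OF h(1) u m] sm[OF T(3)] True by (simp add: hu I_def int_pow_int)
    moreover have "int n \<notin> I p" using n by (simp add: I_def int_pow_int)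
    ultimately have "I p \<subset> I m" using sub by blast
    then have "card (I p) < card (I m)" using fin[OF m] by (rule psubset_card_mono[rotated])
    then show ?thesis using max[OF \<open>P m\<close>] by simp
  next
    case False
    define t where "t = d m (u \<otimes> m)"
    have "t \<le> d m (u \<otimes> p) + d (u \<otimes> p) (u \<otimes> m)"
      unfolding t_def using p u m by (intro dist_triangle) auto
    then have t: "t \<le> 41 * \<delta>" using mid L \<delta>1 p u m by (simp add: dist_left)
    have sq: "2 * d m (u \<otimes> m) \<le> d m (u \<otimes> (u \<otimes> m)) + 2 * \<delta> + 1"
      by (rule loxodromic_square[OF fp p m u mid]) (use L False \<delta>1 in linarith)+
    define W where "W = {y \<in> carrier G. u \<otimes> y = y \<otimes> u \<and> (\<exists>j::int. d (u [^] j \<otimes> m) (y \<otimes> m) \<le> 2 * d m (u \<otimes> m))}"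
    have step: "s \<otimes> y \<in> W" if s: "s \<in> carrier G" "u \<otimes> s = s \<otimes> u" "d p (s \<otimes> p) \<le> 8 * \<delta>" and y: "y \<in> W" for s y
    proof -
      have "d m (s \<otimes> m) \<le> 50 * \<delta>"
        using displacement_move[OF s(1) p m] mid L s(3) \<delta>1 by linarith
      then have r: "4 * d m (u \<otimes> m) + d m (s \<otimes> m) \<le> 400 * \<delta>" using t by (simp add: t_def)
      have "4 * \<delta> + 1 < d m (u \<otimes> m)" using False \<delta>1 by linarith
      from orbit_neighbourhood_invariant[OF fp m u _ s(1) _ s(2) sq this r, of y]
      have "\<exists>j::int. d (u [^] j \<otimes> m) (s \<otimes> y \<otimes> m) \<le> 2 * d m (u \<otimes> m)" using y by (simp add: W_def)
      moreover have "u \<otimes> (s \<otimes> y) = s \<otimes> y \<otimes> u" using y s u by (intro commutes_mult) (simp_all add: W_def)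
      ultimately show ?thesis using y s(1) by (simp add: W_def)
    qed
    have gen: "\<forall>y\<in>W. x \<otimes> y \<in> W" if "x \<in> generate G S" for x
      using that
    proof (induction rule: generate.induct)
      case one then show ?case by (auto simp: W_def)
    next
      case (incl s)
      then have "s \<in> T" by (simp add: T_def)
      then have "s \<in> carrier G" using T by blast
      then show ?case using step[of s] commu[OF _ comm[OF \<open>s \<in> T\<close>]] sp[OF \<open>s \<in> T\<close>] by blast
    next
      case (inv s)
      then have s: "s \<in> T" "s \<in> carrier G" using T by (auto simp: T_def)
      then have "u \<otimes> inv s = inv s \<otimes> u" using u commu[OF _ comm[OF s(1)]] by (intro commutes_inv)
      moreover have "d p (inv s \<otimes> p) \<le> 8 * \<delta>" using sp[OF s(1)] s p by (simp add: displacement_inv)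
      ultimately show ?case using step[of "inv s"] s(2) by blast
    next
      case (eng x y)
      then have "x \<in> carrier G" "y \<in> carrier G" using generate_in_carrier S(2) by auto
      then show ?case using eng.IH by (auto simp: W_def m_assoc)
    qed
    have "\<one> \<in> W" using u m by (auto simp: W_def dist_self intro!: exI[of _ 0])
    define F where "F = {z \<in> carrier G. d m (z \<otimes> m) \<le> 2 * t}"
    have "\<exists>j::int. \<exists>z\<in>F. y = h [^] j \<otimes> z" if "y \<in> generate G S" for y
    proof -
      have y: "y \<in> carrier G" using that generate_in_carrier S(2) by auto
      then have "y \<in> W" using gen[OF that] \<open>\<one> \<in> W\<close> by force
      then obtain j :: int where j: "d (u [^] j \<otimes> m) (y \<otimes> m) \<le> 2 * t"
        by (auto simp: W_def t_def)
      define z where "z = inv (u [^] j) \<otimes> y"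
      have "d m (z \<otimes> m) = d (u [^] j \<otimes> m) (u [^] j \<otimes> (z \<otimes> m))"
        using u m y by (simp add: dist_left z_def)
      also have "u [^] j \<otimes> (z \<otimes> m) = y \<otimes> m" using u m y by (simp add: z_def m_assoc)
      finally have "z \<in> F" using j u y by (simp add: F_def z_def)
      moreover have "y = h [^] (int i * j) \<otimes> z" using u y by (simp add: z_def uj[symmetric])
      ultimately show ?thesis by blast
    qed
    moreover have "finite F" unfolding F_def by (rule displacement_ball[OF m])
    ultimately show ?thesis by (intro exI[of _ F]) (auto simp: F_def)
  qed
qed

end

section \<open>Cayley graphs and asymptotic cones\<close>

context group
begin

abbreviation cayley_adj :: "'a set \<Rightarrow> ('a \<times> 'a) set" where
  "cayley_adj S \<equiv> {(u, v). {u, v} \<in> cayley_edges G S}"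

abbreviation word_dist :: "'a set \<Rightarrow> 'a \<Rightarrow> 'a \<Rightarrow> nat" where
  "word_dist S \<equiv> vertex_dist (cayley_edges G S)"

lemma sym_cayley_adj_pow: "(x, y) \<in> cayley_adj S ^^ n \<Longrightarrow> (y, x) \<in> cayley_adj S ^^ n"
proof (induction n arbitrary: y)
  case (Suc n)
  then obtain z where "(x, z) \<in> cayley_adj S ^^ n" "(z, y) \<in> cayley_adj S" by auto
  then show ?case using Suc.IH by (intro relpow_Suc_I2[of y z]) (auto simp: insert_commute)
qed auto

lemma cayley_adj_cases:
  assumes "S \<subseteq> carrier G" "(x, y) \<in> cayley_adj S"
  obtains s where "s \<in> S" "s \<noteq> \<one>" "x \<in> carrier G" "y = x \<otimes> s"
    | s where "s \<in> S" "s \<noteq> \<one>" "x \<in> carrier G" "y = x \<otimes> inv s"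
proof -
  obtain a s where as: "a \<in> carrier G" "s \<in> S" "s \<noteq> \<one>" "{x, y} = {a, a \<otimes> s}"
    using assms(2) unfolding cayley_edges_def by auto
  have s: "s \<in> carrier G" using as assms by auto
  consider "x = a" "y = a \<otimes> s" | "x = a \<otimes> s" "y = a" using as(4) by (auto simp: doubleton_eq_iff)
  then show thesis
  proof cases
    case 1 then show thesis using that(1) as by blast
  next
    case 2
    then have "y = x \<otimes> inv s" "x \<in> carrier G" using as s by (simp_all add: m_assoc)
    then show thesis using that(2) as by blast
  qed
qed

lemma cayley_adj_pow_carrier:
  assumes "S \<subseteq> carrier G" "(x, y) \<in> cayley_adj S ^^ n" "x \<in> carrier G"
  shows "y \<in> carrier G"
  using assms(2)
proof (induction n arbitrary: y)
  case (Suc n)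
  then obtain z where "(x, z) \<in> cayley_adj S ^^ n" "(z, y) \<in> cayley_adj S" by auto
  then show ?case using assms(1) by (elim cayley_adj_cases[OF assms(1)]) auto
qed (use assms in auto)

lemma cayley_adj_translate:
  assumes S: "S \<subseteq> carrier G" and a: "a \<in> carrier G" and "(x, y) \<in> cayley_adj S ^^ n"
  shows "x \<in> carrier G \<Longrightarrow> (a \<otimes> x, a \<otimes> y) \<in> cayley_adj S ^^ n"
  using assms(3)
proof (induction n arbitrary: y)
  case (Suc n)
  then obtain z where z: "(x, z) \<in> cayley_adj S ^^ n" "(z, y) \<in> cayley_adj S" by auto
  obtain b s where bs: "b \<in> carrier G" "s \<in> S" "s \<noteq> \<one>" "{z, y} = {b, b \<otimes> s}"
    using z(2) unfolding cayley_edges_def by auto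
  have "{a \<otimes> z, a \<otimes> y} = (\<lambda>v. a \<otimes> v) ` {z, y}" by simp
  also have "\<dots> = {a \<otimes> b, (a \<otimes> b) \<otimes> s}" using bs S a by (auto simp: m_assoc)
  finally have "(a \<otimes> z, a \<otimes> y) \<in> cayley_adj S"
    using bs a unfolding cayley_edges_def by blast
  then show ?case using Suc.IH[OF Suc.prems(1) z(1)] by auto
qed auto

lemma cayley_connected:
  assumes S: "S \<subseteq> carrier G" and gen: "generate G S = carrier G"
    and "x \<in> carrier G" "y \<in> carrier G"
  shows "\<exists>n. (x, y) \<in> cayley_adj S ^^ n"
proof -
  have edge: "\<exists>n. (a, a \<otimes> s) \<in> cayley_adj S ^^ n" if "a \<in> carrier G" "s \<in> S" for a s
  proof (cases "s = \<one>")
    case True then show ?thesis using that by (intro exI[of _ 0]) simp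
  next
    case False then show ?thesis
      using that unfolding cayley_edges_def by (intro exI[of _ 1]) auto
  qed
  have "\<forall>a\<in>carrier G. \<exists>n. (a, a \<otimes> k) \<in> cayley_adj S ^^ n" if "k \<in> generate G S" for k
    using that
  proof (induction rule: generate.induct)
    case one
    show ?case by (intro ballI exI[of _ 0]) simp
  next
    case (incl s) then show ?case using edge by blast
  next
    case (inv s)
    then have s: "s \<in> carrier G" using S by auto
    show ?case
    proof
      fix a assume a: "a \<in> carrier G"
      obtain n where "(a \<otimes> inv s, a \<otimes> inv s \<otimes> s) \<in> cayley_adj S ^^ n"
        using edge[of "a \<otimes> inv s" s] a s inv by auto
      then have "(a \<otimes> inv s, a) \<in> cayley_adj S ^^ n" using a s by (simp add: m_assoc)
      then show "\<exists>n. (a, a \<otimes> inv s) \<in> cayley_adj S ^^ n" using sym_cayley_adj_pow by blast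
    qed
  next
    case (eng h k)
    then have c: "h \<in> carrier G" "k \<in> carrier G" using gen by auto
    show ?case
    proof
      fix a assume a: "a \<in> carrier G"
      obtain i where i: "(a, a \<otimes> h) \<in> cayley_adj S ^^ i" using eng.IH(1) a by blast
      obtain j where j: "(a \<otimes> h, a \<otimes> h \<otimes> k) \<in> cayley_adj S ^^ j" using eng.IH(2) a c by blast
      have "(a, a \<otimes> h \<otimes> k) \<in> cayley_adj S ^^ (i + j)" using i j by (auto simp: relpow_add)
      then show "\<exists>n. (a, a \<otimes> (h \<otimes> k)) \<in> cayley_adj S ^^ n" using a c by (auto simp: m_assoc)
    qed
  qed
  then obtain n where "(x, x \<otimes> (inv x \<otimes> y)) \<in> cayley_adj S ^^ n"
    using assms by (metis inv_closed m_closed)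
  then show ?thesis using assms by (auto simp: m_assoc[symmetric])
qed

lemma word_dist_path:
  assumes "S \<subseteq> carrier G" "generate G S = carrier G" "x \<in> carrier G" "y \<in> carrier G"
  shows "(x, y) \<in> cayley_adj S ^^ word_dist S x y"
  unfolding vertex_dist_def using cayley_connected[OF assms] by (rule LeastI_ex)

lemma word_dist_le: "(x, y) \<in> cayley_adj S ^^ n \<Longrightarrow> word_dist S x y \<le> n"
  unfolding vertex_dist_def by (rule Least_le)

text \<open>Vertices of the Cayley graph have finite degree since \<open>S\<close> is finite.\<close>

lemma finite_sphere:
  assumes "finite S" "S \<subseteq> carrier G"
  shows "finite {y. (x, y) \<in> cayley_adj S ^^ n}"
proof (induction n)
  case (Suc n)
  let ?B = "{y. (x, y) \<in> cayley_adj S ^^ n}"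
  have "{y. (x, y) \<in> cayley_adj S ^^ Suc n} \<subseteq> (\<Union>z\<in>?B. (\<lambda>s. z \<otimes> s) ` S \<union> (\<lambda>s. z \<otimes> inv s) ` S)"
  proof
    fix y assume "y \<in> {y. (x, y) \<in> cayley_adj S ^^ Suc n}"
    then obtain z where z: "(x, z) \<in> cayley_adj S ^^ n" "(z, y) \<in> cayley_adj S" by auto
    from z(2) have "y \<in> (\<lambda>s. z \<otimes> s) ` S \<union> (\<lambda>s. z \<otimes> inv s) ` S"
      by (elim cayley_adj_cases[OF assms(2)]) auto
    then show "y \<in> (\<Union>z\<in>?B. (\<lambda>s. z \<otimes> s) ` S \<union> (\<lambda>s. z \<otimes> inv s) ` S)" using z(1) by blast
  qed
  then show ?case using Suc assms(1) by (elim finite_subset) auto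
qed auto

lemma word_dist_metric:
  assumes fin: "finite S" and S: "S \<subseteq> carrier G" and gen: "generate G S = carrier G"
  shows "x \<in> carrier G \<Longrightarrow> word_dist S x x = 0"
    and "x \<in> carrier G \<Longrightarrow> y \<in> carrier G \<Longrightarrow> word_dist S x y = word_dist S y x"
    and "x \<in> carrier G \<Longrightarrow> y \<in> carrier G \<Longrightarrow> z \<in> carrier G \<Longrightarrow>
      word_dist S x z \<le> word_dist S x y + word_dist S y z"
    and "a \<in> carrier G \<Longrightarrow> x \<in> carrier G \<Longrightarrow> y \<in> carrier G \<Longrightarrow>
      word_dist S (a \<otimes> x) (a \<otimes> y) = word_dist S x y"
    and "x \<in> carrier G \<Longrightarrow> y \<in> carrier G \<Longrightarrow>
      \<exists>m\<in>carrier G. 2 * word_dist S x m \<le> word_dist S x y + 1 \<and> 2 * word_dist S m y \<le> word_dist S x y + 1"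
    and "finite {x \<in> carrier G. word_dist S \<one> x \<le> r}"
proof -
  note path = word_dist_path[OF S gen] and le = word_dist_le
  show "word_dist S x x = 0" if "x \<in> carrier G" using le[where n = 0 and x = x and y = x] by simp
  have "word_dist S x y \<le> word_dist S y x" if "x \<in> carrier G" "y \<in> carrier G" for x y
    using le sym_cayley_adj_pow path that by metis
  then show "word_dist S x y = word_dist S y x" if "x \<in> carrier G" "y \<in> carrier G"
    using that by (simp add: order_antisym)
  show "word_dist S x z \<le> word_dist S x y + word_dist S y z"
    if "x \<in> carrier G" "y \<in> carrier G" "z \<in> carrier G"
    using path[of x y] path[of y z] that by (intro le) (auto simp: relpow_add)
  have tr: "word_dist S (a \<otimes> x) (a \<otimes> y) \<le> word_dist S x y"
    if "a \<in> carrier G" "x \<in> carrier G" "y \<in> carrier G" for a x y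
    using that path by (intro le cayley_adj_translate[OF S])
  show "word_dist S (a \<otimes> x) (a \<otimes> y) = word_dist S x y"
    if "a \<in> carrier G" "x \<in> carrier G" "y \<in> carrier G"
    using tr[of a x y] tr[of "inv a" "a \<otimes> x" "a \<otimes> y"] that by (simp add: m_assoc[symmetric])
  show "\<exists>m\<in>carrier G. 2 * word_dist S x m \<le> word_dist S x y + 1 \<and> 2 * word_dist S m y \<le> word_dist S x y + 1"
    if "x \<in> carrier G" "y \<in> carrier G"
  proof -
    define k where "k = word_dist S x y div 2"
    define l where "l = word_dist S x y - k"
    have "(x, y) \<in> cayley_adj S ^^ (k + l)" using path[OF that] by (simp add: k_def l_def)
    then obtain m where m: "(x, m) \<in> cayley_adj S ^^ k" "(m, y) \<in> cayley_adj S ^^ l"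
      unfolding relpow_add by auto
    have "m \<in> carrier G" using cayley_adj_pow_carrier[OF S m(1) that(1)] .
    moreover have "word_dist S x m \<le> k" "word_dist S m y \<le> l" using le m by auto
    ultimately show ?thesis unfolding l_def k_def by (intro bexI[of _ m]) auto
  qed
  have "{x \<in> carrier G. word_dist S \<one> x \<le> r} \<subseteq> (\<Union>n\<le>r. {y. (\<one>, y) \<in> cayley_adj S ^^ n})"
    using path[of \<one>] by auto
  then show "finite {x \<in> carrier G. word_dist S \<one> x \<le> r}"
    by (rule finite_subset) (use finite_sphere[OF fin S] in auto)
qed

text \<open>A point of the realization is within distance \<open>1\<close> of each vertex of its support. This
  coarse comparison with the word metric is all that a cone sees of the metric of the
  realization.\<close>

lemma realization_dist_approx:
  assumes fin: "finite S" and S: "S \<subseteq> carrier G" and gen: "generate G S = carrier G"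
    and p: "p \<in> cayley_space G S" and q: "q \<in> cayley_space G S"
    and u: "u \<in> supp p" and v: "v \<in> supp q"
  shows "\<bar>cayley_dist G S p q - real (word_dist S u v)\<bar> \<le> 2"
proof -
  note dist = word_dist_metric[OF fin S gen]
  have supp: "finite (supp p) \<and> supp p \<subseteq> carrier G \<and> (\<forall>a\<in>supp p. \<forall>b\<in>supp p. word_dist S a b \<le> 1)
      \<and> (\<forall>a. 0 \<le> p a) \<and> (\<forall>a\<in>supp p. p a \<le> 1) \<and> (\<Sum>a\<in>supp p. p a) = 1"
    if p: "p \<in> cayley_space G S" for p :: "'a \<Rightarrow> real"
  proof -
    have nonneg: "\<forall>a. 0 \<le> p a" and sum: "(\<Sum>a\<in>supp p. p a) = 1"
      and disj: "supp p \<in> cayley_edges G S \<or> (\<exists>v\<in>carrier G. supp p = {v})"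
      using p by (auto simp: realization_def)
    from disj have "\<exists>a\<in>carrier G. \<exists>b\<in>carrier G. supp p = {a, b} \<and> (a = b \<or> {a, b} \<in> cayley_edges G S)"
    proof
      assume e: "supp p \<in> cayley_edges G S"
      then obtain a s where "a \<in> carrier G" "s \<in> S" "supp p = {a, a \<otimes> s}"
        unfolding cayley_edges_def by auto
      then show ?thesis using e S by (intro bexI[of _ a] bexI[of _ "a \<otimes> s"]) auto
    next
      assume "\<exists>v\<in>carrier G. supp p = {v}"
      then show ?thesis by auto
    qed
    then obtain a b where ab: "a \<in> carrier G" "b \<in> carrier G" "supp p = {a, b}"
      "a = b \<or> {a, b} \<in> cayley_edges G S" by blast
    have "word_dist S a b \<le> 1"
    proof (cases "a = b")
      case False
      then show ?thesis using ab by (intro word_dist_le) auto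
    qed (use dist(1) ab in simp)
    then have d: "\<forall>x\<in>supp p. \<forall>y\<in>supp p. word_dist S x y \<le> 1"
      using ab dist(1,2) by auto
    have "p x \<le> 1" if "x \<in> supp p" for x
      using member_le_sum[of x "supp p" p] that nonneg sum ab by simp
    then show ?thesis using ab d nonneg sum by auto
  qed
  note sp = supp[OF p] and sq = supp[OF q]
  have lip: "word_dist S u v \<le> word_dist S a b + 2" if "a \<in> supp p" "b \<in> supp q" for a b
  proof -
    have "word_dist S u v \<le> word_dist S u a + word_dist S a v" using that sp sq u v by (intro dist) auto
    also have "word_dist S a v \<le> word_dist S a b + word_dist S b v" using that sp sq u v by (intro dist) auto
    finally have "word_dist S u v \<le> word_dist S u a + (word_dist S a b + word_dist S b v)" by simp
    moreover have "word_dist S u a \<le> 1" "word_dist S b v \<le> 1" using that sp sq u v by auto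
    ultimately show ?thesis by simp
  qed
  show ?thesis
  proof (cases "supp p = supp q")
    case True
    have "(\<Sum>a\<in>supp p. \<bar>p a - q a\<bar>) \<le> (\<Sum>a\<in>supp p. p a + q a)"
      using sp sq by (intro sum_mono) (auto simp: abs_le_iff add_increasing)
    also have "\<dots> = 2" using sp sq True by (simp add: sum.distrib)
    finally have "(\<Sum>a\<in>supp p. \<bar>p a - q a\<bar>) / 2 \<le> 1" by simp
    moreover have "0 \<le> (\<Sum>a\<in>supp p. \<bar>p a - q a\<bar>) / 2" by (simp add: sum_nonneg)
    moreover have "real (word_dist S u v) \<le> 1" using sp u v True by simp
    moreover have "cayley_dist G S p q = (\<Sum>a\<in>supp p. \<bar>p a - q a\<bar>) / 2"
      using True by (simp add: realization_dist_def)
    ultimately show ?thesis by linarith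
  next
    case False
    define f where "f = (\<lambda>(u, v). (1 - p u) + real (word_dist S u v) + (1 - q v))"
    have eq: "cayley_dist G S p q = Min (f ` (supp p \<times> supp q))"
      using False by (simp add: realization_dist_def f_def)
    have finf: "finite (f ` (supp p \<times> supp q))" using sp sq by simp
    have "Min (f ` (supp p \<times> supp q)) \<le> f (u, v)" using finf u v by (intro Min_le) auto
    moreover have "f (u, v) \<le> real (word_dist S u v) + 2"
    proof -
      have "0 \<le> p u" "0 \<le> q v" using sp sq by auto
      then show ?thesis by (simp add: f_def)
    qed
    moreover have "real (word_dist S u v) - 2 \<le> Min (f ` (supp p \<times> supp q))"
    proof (rule Min.boundedI[OF finf])
      show "f ` (supp p \<times> supp q) \<noteq> {}" using u v by auto
      fix c assume "c \<in> f ` (supp p \<times> supp q)"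
      then obtain a b where ab: "a \<in> supp p" "b \<in> supp q" "c = f (a, b)" by auto
      have "real (word_dist S u v) \<le> real (word_dist S a b) + 2" using lip[OF ab(1,2)] by linarith
      moreover have "p a \<le> 1" "q b \<le> 1" using sp sq ab by auto
      ultimately show "real (word_dist S u v) - 2 \<le> c" by (simp add: ab(3) f_def)
    qed
    ultimately show ?thesis using eq by linarith
  qed
qed

end

lemma nonprincipal_ultrafilter_sequentially:
  assumes "nonprincipal_ultrafilter \<omega>" "eventually P sequentially"
  shows "eventually P \<omega>"
proof -
  obtain N where N: "\<And>n. N \<le> n \<Longrightarrow> P n" using assms(2) by (auto simp: eventually_sequentially)
  have ne: "eventually (\<lambda>n. n \<noteq> k) \<omega>" for k
    using assms(1) unfolding nonprincipal_ultrafilter_def by blast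
  have "eventually (\<lambda>n. \<forall>k\<in>{..<N}. n \<noteq> k) \<omega>"
    using ne by (intro eventually_ball_finite) auto
  then show ?thesis
    by (rule eventually_mono) (use N in \<open>metis lessThan_iff not_less\<close>)
qed

text \<open>A cluster point of the image filter exists by compactness of the interval, and an
  ultrafilter converges to each of its cluster points.\<close>

lemma ultrafilter_bounded_convergent:
  fixes f :: "nat \<Rightarrow> real"
  assumes \<omega>: "nonprincipal_ultrafilter \<omega>" and b: "eventually (\<lambda>n. \<bar>f n\<bar> \<le> C) \<omega>"
  shows "\<exists>l. (f \<longlongrightarrow> l) \<omega>"
proof -
  let ?F = "filtermap f \<omega>"
  have "?F \<noteq> bot" using \<omega> by (simp add: nonprincipal_ultrafilter_def filtermap_bot_iff)
  moreover have "eventually (\<lambda>x. x \<in> {- C..C}) ?F"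
    using b by (auto simp: eventually_filtermap elim!: eventually_mono)
  ultimately obtain l where l: "inf (nhds l) ?F \<noteq> bot"
    using compact_Icc[of "- C" C] unfolding compact_filter by blast
  have "eventually (\<lambda>n. f n \<in> U) \<omega>" if U: "open U" "l \<in> U" for U
  proof (rule ccontr)
    assume "\<not> ?thesis"
    then have "eventually (\<lambda>n. f n \<notin> U) \<omega>" using \<omega> unfolding nonprincipal_ultrafilter_def by blast
    then have "eventually (\<lambda>x. x \<notin> U) ?F" by (simp add: eventually_filtermap)
    moreover have "eventually (\<lambda>x. x \<in> U) (nhds l)" using U by (simp add: eventually_nhds_in_open)
    ultimately have "eventually (\<lambda>x. False) (inf (nhds l) ?F)"
      unfolding eventually_inf by blast
    then show False using l by (simp add: trivial_limit_def)
  qed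
  then show ?thesis by (auto simp: tendsto_def)
qed

definition vertex_point :: "'v \<Rightarrow> 'v \<Rightarrow> real" where
  "vertex_point x = (\<lambda>v. if v = x then 1 else 0)"

lemma supp_vertex_point [simp]: "supp (vertex_point x) = {x}"
  by (auto simp: supp_def vertex_point_def)

lemma vertex_point_in_realization: "x \<in> V \<Longrightarrow> vertex_point x \<in> realization V E"
  by (auto simp: realization_def) (auto simp: vertex_point_def)

lemma supp_nonempty: "p \<in> realization V E \<Longrightarrow> supp p \<noteq> {}"
  by (force simp: realization_def)

context group
begin

definition support_vertex :: "('a \<Rightarrow> real) \<Rightarrow> 'a" where
  "support_vertex p = (SOME v. v \<in> supp p)"

lemma support_vertex: "p \<in> realization V E \<Longrightarrow> support_vertex p \<in> supp p"
  unfolding support_vertex_def using supp_nonempty some_in_eq by blast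

lemma supp_cayley_space:
  assumes "S \<subseteq> carrier G" "p \<in> cayley_space G S"
  shows "supp p \<subseteq> carrier G"
  using assms(2) subsetD[OF assms(1)] by (fastforce simp: realization_def cayley_edges_def)

text \<open>The representatives selected in the cone distance need not be sequences of vertices.
  They are at distance \<open>o(s n)\<close> from the given ones, and passing to support vertices costs
  a bounded error, so the limit is unaffected.\<close>

lemma cone_class_distance:
  fixes s :: "nat \<Rightarrow> real" and x y :: "nat \<Rightarrow> 'a"
  assumes fin: "finite S" and S: "S \<subseteq> carrier G" and gen: "generate G S = carrier G"
    and \<omega>: "\<omega> \<noteq> bot" and s: "\<And>n. 0 < s n" "filterlim s at_top \<omega>"
    and x: "\<And>n. x n \<in> carrier G" "(\<lambda>n. vertex_point (x n)) \<in> cone_seqs (cayley_space G S) (cayley_dist G S) \<omega> s e"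
    and y: "\<And>n. y n \<in> carrier G" "(\<lambda>n. vertex_point (y n)) \<in> cone_seqs (cayley_space G S) (cayley_dist G S) \<omega> s e"
    and lim: "((\<lambda>n. real (word_dist S (x n) (y n)) / s n) \<longlongrightarrow> l) \<omega>"
  defines "cls \<equiv> \<lambda>z. cone_rel (cayley_space G S) (cayley_dist G S) \<omega> s e `` {\<lambda>n. vertex_point (z n)}"
  shows "cone_dist (cayley_dist G S) \<omega> s (cls x) (cls y) = l"
proof -
  let ?X = "cayley_space G S" and ?D = "cayley_dist G S"
  note dist = word_dist_metric[OF fin S gen] and approx = realization_dist_approx[OF fin S gen]
  have rep: "(SOME p. p \<in> cls z) \<in> cls z"
    if "(\<lambda>n. vertex_point (z n)) \<in> cone_seqs ?X ?D \<omega> s e" for z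
  proof -
    have "(\<lambda>n. vertex_point (z n)) \<in> cls z"
      using that by (simp add: cls_def cone_rel_def realization_dist_def)
    then show ?thesis by (rule someI[of "\<lambda>p. p \<in> cls z"])
  qed
  have cls: "(\<forall>n. p n \<in> ?X) \<and> ((\<lambda>n. ?D (vertex_point (z n)) (p n) / s n) \<longlongrightarrow> 0) \<omega>"
    if "p \<in> cls z" for p z
    using that by (auto simp: cls_def cone_rel_def cone_seqs_def)
  define p q where "p = (SOME p. p \<in> cls x)" and "q = (SOME p. p \<in> cls y)"
  have p: "\<And>n. p n \<in> ?X" "((\<lambda>n. ?D (vertex_point (x n)) (p n) / s n) \<longlongrightarrow> 0) \<omega>"
    using cls[OF rep[OF x(2)]] by (simp_all add: p_def)
  have q: "\<And>n. q n \<in> ?X" "((\<lambda>n. ?D (vertex_point (y n)) (q n) / s n) \<longlongrightarrow> 0) \<omega>"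
    using cls[OF rep[OF y(2)]] by (simp_all add: q_def)
  define P Q where "P n = ?D (vertex_point (x n)) (p n)" and "Q n = ?D (vertex_point (y n)) (q n)" for n
  have close: "\<bar>?D (p n) (q n) - real (word_dist S (x n) (y n))\<bar> \<le> P n + Q n + 6" for n
  proof -
    define a b where "a = support_vertex (p n)" and "b = support_vertex (q n)"
    have ab: "a \<in> supp (p n)" "b \<in> supp (q n)"
      unfolding a_def b_def using support_vertex p(1) q(1) by blast+
    then have c: "a \<in> carrier G" "b \<in> carrier G"
      using supp_cayley_space[OF S] p(1) q(1) by blast+
    have "\<bar>P n - real (word_dist S (x n) a)\<bar> \<le> 2"
      unfolding P_def using x(1) p(1) ab by (intro approx vertex_point_in_realization) auto
    moreover have "\<bar>Q n - real (word_dist S (y n) b)\<bar> \<le> 2"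
      unfolding Q_def using y(1) q(1) ab by (intro approx vertex_point_in_realization) auto
    moreover have "\<bar>?D (p n) (q n) - real (word_dist S a b)\<bar> \<le> 2"
      using p(1) q(1) ab by (intro approx) auto
    moreover have "word_dist S (x n) (y n) \<le> word_dist S (x n) a + word_dist S a b + word_dist S (y n) b"
      using dist(3)[of "x n" a "y n"] dist(3)[of a b "y n"] dist(2)[of b "y n"] c x(1) y(1) by fastforce
    moreover have "word_dist S a b \<le> word_dist S (x n) a + word_dist S (x n) (y n) + word_dist S (y n) b"
      using dist(3)[of a "x n" b] dist(3)[of "x n" "y n" b] dist(2)[of a "x n"] c x(1) y(1) by fastforce
    ultimately show ?thesis by linarith
  qed
  have "((\<lambda>n. P n / s n + Q n / s n + 6 / s n) \<longlongrightarrow> 0 + 0 + 0) \<omega>"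
    using p(2) q(2) unfolding P_def Q_def
    by (intro tendsto_add tendsto_divide_0[OF tendsto_const] filterlim_at_top_imp_at_infinity s)
  then have "((\<lambda>n. (P n + Q n + 6) / s n) \<longlongrightarrow> 0) \<omega>"
    by (simp add: add_divide_distrib)
  then have "((\<lambda>n. ?D (p n) (q n) / s n - real (word_dist S (x n) (y n)) / s n) \<longlongrightarrow> 0) \<omega>"
  proof (rule Lim_null_comparison[rotated], intro always_eventually allI)
    fix n
    show "norm (?D (p n) (q n) / s n - real (word_dist S (x n) (y n)) / s n) \<le> (P n + Q n + 6) / s n"
      using close[of n] s(1)[of n] by (simp add: diff_divide_distrib[symmetric] divide_right_mono)
  qed
  from tendsto_add[OF this lim] have "((\<lambda>n. ?D (p n) (q n) / s n) \<longlongrightarrow> l) \<omega>" by simp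
  then show ?thesis
    unfolding cone_dist_def p_def q_def using \<omega> by (intro tendsto_Lim)
qed

text \<open>If the claim fails, every scale \<open>\<delta>\<close> from \<open>c\<close> on has a violating quadruple, in particular
  the integer part of \<open>s n\<close> when \<open>n\<close> is large. Left translation brings it near the
  basepoint \<open>e n\<close>, and the limits of these quadruples are four points of the cone which
  violate the four-point condition by at least \<open>1\<close>.\<close>

theorem hyperbolic_at_cone_scales:
  fixes s :: "nat \<Rightarrow> real"
  assumes fin: "finite S" and S: "S \<subseteq> carrier G" and gen: "generate G S = carrier G"
    and \<omega>: "nonprincipal_ultrafilter \<omega>" and s: "\<And>n. 0 < s n" "filterlim s at_top sequentially"
    and e: "\<And>n. e n \<in> cayley_space G S"
    and tree: "real_tree (asymptotic_cone (cayley_space G S) (cayley_dist G S) \<omega> s e)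
                 (cone_dist (cayley_dist G S) \<omega> s)"
  shows "\<exists>\<delta>\<ge>c. four_point_in_balls (carrier G) (word_dist S) (k * \<delta>) \<delta>"
proof (rule ccontr)
  assume "\<not> ?thesis"
  then have neg: "\<not> four_point_in_balls (carrier G) (word_dist S) (k * \<delta>) \<delta>" if "c \<le> \<delta>" for \<delta>
    using that by blast
  let ?X = "cayley_space G S" and ?D = "cayley_dist G S" and ?d = "word_dist S"
  note dist = word_dist_metric[OF fin S gen] and approx = realization_dist_approx[OF fin S gen]
  define v where "v n = support_vertex (e n)" for n
  have v: "v n \<in> supp (e n)" "v n \<in> carrier G" for n
    using support_vertex[OF e] supp_cayley_space[OF S e] by (auto simp: v_def)
  define quad where "quad n x y z w \<longleftrightarrow> x \<in> carrier G \<and> y \<in> carrier G \<and> z \<in> carrier G \<and> w \<in> carrier G \<and>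
      (\<forall>a\<in>{x, y, z, w}. ?d (v n) a \<le> k * s n) \<and>
      (s n \<ge> c + 1 \<longrightarrow> max (?d x z + ?d y w) (?d x w + ?d y z) + (s n - 1) \<le> real (?d x y + ?d z w))" for n x y z w
  have "\<exists>x y z w. quad n x y z w" for n
  proof (cases "s n \<ge> c + 1")
    case False
    then show ?thesis using v(2)[of n] dist(1) less_imp_le[OF s(1)] by (intro exI[of _ "v n"]) (auto simp: quad_def)
  next
    case True
    \<comment> \<open>The bounds \<open>s n - 1 \<le> \<delta> \<le> s n\<close> hold for this \<open>\<delta>\<close>; the loss of \<open>1\<close> vanishes after
      rescaling.\<close>
    define \<delta> where "\<delta> = nat \<lfloor>s n\<rfloor>"
    have \<delta>: "real \<delta> \<le> s n" "s n - 1 \<le> real \<delta>" "c \<le> \<delta>" using True by (auto simp: \<delta>_def le_nat_floor)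
    obtain b x y z w where c: "b \<in> carrier G" "x \<in> carrier G" "y \<in> carrier G" "z \<in> carrier G" "w \<in> carrier G"
      and near: "\<forall>a\<in>{x, y, z, w}. ?d b a \<le> k * \<delta>"
      and viol: "max (?d x z + ?d y w) (?d x w + ?d y z) + \<delta> < ?d x y + ?d z w"
      using neg[OF \<delta>(3)] unfolding four_point_in_balls_def by (auto simp: not_le)
    \<comment> \<open>Left translation by \<open>v n \<otimes> inv b\<close> moves the centre of the ball to the vertex \<open>v
      n\<close> next to the basepoint.\<close>
    define T where "T a = v n \<otimes> (inv b \<otimes> a)" for a
    have T: "T a \<in> carrier G" if "a \<in> carrier G" for a using that c v by (simp add: T_def)
    have iso: "?d (T a) (T a') = ?d a a'" if "a \<in> carrier G" "a' \<in> carrier G" for a a'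
      using that c v by (simp add: T_def dist(4))
    have "T b = v n" using c v by (simp add: T_def)
    then have radius: "?d (v n) (T a) \<le> k * s n" if "a \<in> {x, y, z, w}" for a
    proof -
      have "?d (v n) (T a) = ?d b a" using iso[of b a] \<open>T b = v n\<close> that c by auto
      then have "?d (v n) (T a) \<le> k * \<delta>" using near that by auto
      then have "real (?d (v n) (T a)) \<le> real (k * \<delta>)" by (simp only: of_nat_le_iff)
      also have "\<dots> \<le> k * s n" using \<delta>(1) by (simp add: mult_left_mono)
      finally show ?thesis .
    qed
    have gap: "max (?d (T x) (T z) + ?d (T y) (T w)) (?d (T x) (T w) + ?d (T y) (T z)) + (s n - 1)
        \<le> real (?d (T x) (T y) + ?d (T z) (T w))"
      using viol \<delta>(2) c by (simp add: iso)
    have "quad n (T x) (T y) (T z) (T w)"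
      unfolding quad_def
    proof (intro conjI ballI impI)
      show "?d (v n) a \<le> k * s n" if "a \<in> {T x, T y, T z, T w}" for a
        using that radius by blast
    qed (use T c gap in blast)+
    then show ?thesis by blast
  qed
  then obtain x y z w where quad: "\<And>n. quad n (x n) (y n) (z n) (w n)" by metis
  then have c: "\<And>n. x n \<in> carrier G" "\<And>n. y n \<in> carrier G" "\<And>n. z n \<in> carrier G" "\<And>n. w n \<in> carrier G"
    and near: "\<And>n a. a \<in> {x n, y n, z n, w n} \<Longrightarrow> ?d (v n) a \<le> k * s n"
    and viol: "\<And>n. s n \<ge> c + 1 \<Longrightarrow> max (?d (x n) (z n) + ?d (y n) (w n)) (?d (x n) (w n) + ?d (y n) (z n)) + (s n - 1)
        \<le> real (?d (x n) (y n) + ?d (z n) (w n))"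
    by (auto simp only: quad_def)
  have \<omega>b: "\<omega> \<noteq> bot" using \<omega> by (simp add: nonprincipal_ultrafilter_def)
  have "\<omega> \<le> sequentially"
    using nonprincipal_ultrafilter_sequentially[OF \<omega>] by (simp add: le_filter_def)
  then have s\<omega>: "filterlim s at_top \<omega>" using s(2) filterlim_mono by blast
  have large: "eventually (\<lambda>n. s n \<ge> r) \<omega>" for r using s\<omega> by (simp add: filterlim_at_top)
  define cls where "cls a = cone_rel ?X ?D \<omega> s e `` {\<lambda>n. vertex_point (a n)}" for a :: "nat \<Rightarrow> 'a"
  define good where "good a \<longleftrightarrow> (\<forall>n. a n \<in> carrier G \<and> ?d (v n) (a n) \<le> k * s n)" for a
  have good: "good x" "good y" "good z" "good w" using c near by (auto simp: good_def)
  have seqs: "(\<lambda>n. vertex_point (a n)) \<in> cone_seqs ?X ?D \<omega> s e" if a: "good a" for a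
  proof -
    have "?D (vertex_point (a n)) (e n) / s n \<le> k + 2" if "s n \<ge> 1" for n
    proof -
      have "\<bar>?D (vertex_point (a n)) (e n) - ?d (a n) (v n)\<bar> \<le> 2"
        using a e v by (intro approx vertex_point_in_realization) (auto simp: good_def)
      moreover have "?d (a n) (v n) \<le> k * s n" using a v dist(2)[of "a n" "v n"] by (simp add: good_def)
      ultimately have "?D (vertex_point (a n)) (e n) \<le> (k + 2) * s n" using that by (simp add: algebra_simps)
      then show ?thesis using s(1)[of n] by (simp add: divide_le_eq)
    qed
    then have "eventually (\<lambda>n. ?D (vertex_point (a n)) (e n) / s n \<le> k + 2) \<omega>"
      using large[of 1] by (auto elim: eventually_mono)
    then show ?thesis using a by (auto simp: cone_seqs_def good_def vertex_point_in_realization)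
  qed
  have cls: "cls a \<in> asymptotic_cone ?X ?D \<omega> s e" if "good a" for a
    using seqs[OF that] by (simp add: cls_def asymptotic_cone_def quotientI)
  have conv: "((\<lambda>n. real (?d (a n) (b n)) / s n) \<longlongrightarrow> cone_dist ?D \<omega> s (cls a) (cls b)) \<omega>"
    if ab: "good a" "good b" for a b
  proof -
    have "\<bar>real (?d (a n) (b n)) / s n\<bar> \<le> 2 * k" for n
    proof -
      have "?d (a n) (b n) \<le> ?d (v n) (a n) + ?d (v n) (b n)"
        using dist(3)[of "a n" "v n" "b n"] dist(2)[of "a n" "v n"] v ab by (simp add: good_def)
      moreover have "?d (v n) (a n) \<le> k * s n" "?d (v n) (b n) \<le> k * s n" using ab by (auto simp: good_def)
      ultimately have "real (?d (a n) (b n)) \<le> 2 * k * s n" by linarith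
      then show ?thesis using s(1)[of n] by (simp add: divide_le_eq)
    qed
    then have "eventually (\<lambda>n. \<bar>real (?d (a n) (b n)) / s n\<bar> \<le> 2 * k) \<omega>"
      by (intro always_eventually allI)
    from ultrafilter_bounded_convergent[OF \<omega> this]
    obtain l where l: "((\<lambda>n. real (?d (a n) (b n)) / s n) \<longlongrightarrow> l) \<omega>" ..
    have "cone_dist ?D \<omega> s (cls a) (cls b) = l"
      unfolding cls_def
      by (rule cone_class_distance[OF fin S gen \<omega>b s(1) s\<omega> _ seqs[OF ab(1)] _ seqs[OF ab(2)] l])
         (use ab in \<open>simp_all add: good_def\<close>)
    then show ?thesis using l by simp
  qed
  define D where "D a b = cone_dist ?D \<omega> s (cls a) (cls b)" for a b
  have "max (D x z + D y w) (D x w + D y z) + (1 - 0) \<le> D x y + D z w"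
  proof (rule tendsto_le[OF \<omega>b])
    show "((\<lambda>n. ?d (x n) (y n) / s n + ?d (z n) (w n) / s n) \<longlongrightarrow> D x y + D z w) \<omega>"
      unfolding D_def by (intro tendsto_add conv good)
    show "((\<lambda>n. max (?d (x n) (z n) / s n + ?d (y n) (w n) / s n) (?d (x n) (w n) / s n + ?d (y n) (z n) / s n)
        + (1 - 1 / s n)) \<longlongrightarrow> max (D x z + D y w) (D x w + D y z) + (1 - 0)) \<omega>"
      unfolding D_def
      by (intro tendsto_add tendsto_max tendsto_diff tendsto_const conv good
          tendsto_divide_0[OF tendsto_const] filterlim_at_top_imp_at_infinity s\<omega>)
    show "eventually (\<lambda>n. max (?d (x n) (z n) / s n + ?d (y n) (w n) / s n) (?d (x n) (w n) / s n + ?d (y n) (z n) / s n)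
        + (1 - 1 / s n) \<le> ?d (x n) (y n) / s n + ?d (z n) (w n) / s n) \<omega>"
      using large[of "c + 1"]
    proof (rule eventually_mono)
      fix n assume "s n \<ge> c + 1"
      have scale: "A / s n + B / s n + (1 - 1 / s n) \<le> C / s n + E / s n"
        if "A + B + (s n - 1) \<le> C + E" for A B C E :: real
        using divide_right_mono[OF that, of "s n"] s(1)[of n]
        by (simp add: add_divide_distrib diff_divide_distrib)
      let ?m = "max (?d (x n) (z n) + ?d (y n) (w n)) (?d (x n) (w n) + ?d (y n) (z n))"
      have "?d (x n) (z n) + ?d (y n) (w n) \<le> ?m" "?d (x n) (w n) + ?d (y n) (z n) \<le> ?m" by simp_all
      then have v: "real (?d (x n) (z n)) + real (?d (y n) (w n)) + (s n - 1) \<le> real (?d (x n) (y n)) + real (?d (z n) (w n))"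
        "real (?d (x n) (w n)) + real (?d (y n) (z n)) + (s n - 1) \<le> real (?d (x n) (y n)) + real (?d (z n) (w n))"
        using viol[OF \<open>s n \<ge> c + 1\<close>] by linarith+
      show "max (?d (x n) (z n) / s n + ?d (y n) (w n) / s n) (?d (x n) (w n) / s n + ?d (y n) (z n) / s n)
        + (1 - 1 / s n) \<le> ?d (x n) (y n) / s n + ?d (z n) (w n) / s n"
        using scale[OF v(1)] scale[OF v(2)] by (auto simp: max_def)
    qed
  qed
  moreover have "D x y + D z w \<le> max (D x z + D y w) (D x w + D y z)"
    unfolding D_def by (intro real_tree_space.four_point[OF real_tree_space.intro[OF tree]] cls good)
  ultimately show False by linarith
qed

theorem locally_hyperbolic:
  assumes "lacunary_hyperbolic G"
  obtains d where "locally_hyperbolic_group G d"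
proof -
  obtain S \<omega> s e where S: "finite S" "S \<subseteq> carrier G" "generate G S = carrier G"
    and cone: "nonprincipal_ultrafilter \<omega>" "\<And>n. 0 < s n" "filterlim s at_top sequentially"
      "\<And>n. e n \<in> cayley_space G S"
      "real_tree (asymptotic_cone (cayley_space G S) (cayley_dist G S) \<omega> s e)
                 (cone_dist (cayley_dist G S) \<omega> s)"
    using assms unfolding lacunary_hyperbolic_def by blast
  have "locally_hyperbolic_group G (word_dist S)"
    using word_dist_metric[OF S] hyperbolic_at_cone_scales[OF S cone]
    by unfold_locales auto
  then show thesis by (rule that)
qed

end

section \<open>Central cyclic subgroups of finite index\<close>

context group begin

text \<open>This is the transfer from \<open>K\<close> to its central subgroup \<open>\<langle>h\<rangle>\<close>, with values read as
  exponents. For a transversal \<open>T\<close> of the cosets, right multiplication by \<open>x\<close> permutes the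
  cosets and changes the representatives by powers of \<open>h\<close>; the exponents \<open>c (t \<otimes> x)\<close> form
  a cocycle, and their sum over \<open>T\<close> is additive in \<open>x\<close>.\<close>

lemma transfer_to_central_powers:
  assumes K: "subgroup K G" and h: "h \<in> K" "\<And>n::nat. n > 0 \<Longrightarrow> h [^] n \<noteq> \<one>"
    and central: "\<And>x. x \<in> K \<Longrightarrow> x \<otimes> h = h \<otimes> x"
    and F: "finite F" "F \<subseteq> carrier G" "\<And>y. y \<in> K \<Longrightarrow> \<exists>j::int. \<exists>z\<in>F. y = h [^] j \<otimes> z"
  obtains \<Phi> :: "'a \<Rightarrow> int" where "\<And>x y. x \<in> K \<Longrightarrow> y \<in> K \<Longrightarrow> \<Phi> (x \<otimes> y) = \<Phi> x + \<Phi> y" "0 < \<Phi> h"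
proof -
  have KG: "x \<in> carrier G" if "x \<in> K" for x using subgroup.subset[OF K] that by blast
  have hG: "h \<in> carrier G" using KG h(1) .
  have hK: "h [^] j \<otimes> x \<in> K" if "x \<in> K" for j :: int and x
    using that h(1) K by (simp add: subgroup_int_pow_closed subgroup.m_closed)
  have add: "h [^] i \<otimes> (h [^] j \<otimes> x) = h [^] (i + j) \<otimes> x" if "x \<in> carrier G" for i j :: int and x
    using that hG by (simp add: int_pow_mult m_assoc)
  have exponent: "i = j" if "h [^] i \<otimes> x = h [^] j \<otimes> x" "x \<in> carrier G" for i j :: int and x
    using inj_int_pow[OF hG h(2)] that hG by (simp add: inj_def)
  \<comment> \<open>Representatives are chosen per orbit of \<open>\<langle>h\<rangle>\<close>, so that \<open>r\<close> is constant on
    orbits.\<close>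
  define orb where "orb x = {h [^] j \<otimes> x | j::int. True}" for x
  define r where "r x = (SOME z. z \<in> orb x)" for x
  have orb_shift: "orb (h [^] i \<otimes> x) = orb x" if "x \<in> carrier G" for i :: int and x
  proof -
    have "h [^] j \<otimes> x = h [^] (j - i) \<otimes> (h [^] i \<otimes> x)" for j using add[OF that] by simp
    then show ?thesis unfolding orb_def using add[OF that] by blast
  qed
  have r_shift: "r (h [^] i \<otimes> x) = r x" if "x \<in> carrier G" for i :: int and x
    using orb_shift[OF that] by (simp add: r_def)
  have r_orb: "r x \<in> orb x" if "x \<in> carrier G" for x
  proof -
    have "h [^] (0::int) \<otimes> x \<in> orb x" unfolding orb_def by blast
    then show ?thesis unfolding r_def by (rule someI[of "\<lambda>z. z \<in> orb x"])
  qed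
  have "\<exists>j::int. x = h [^] j \<otimes> r x" if "x \<in> carrier G" for x
  proof -
    have "r x \<in> orb x" using that by (rule r_orb)
    then obtain j :: int where "r x = h [^] j \<otimes> x" by (auto simp: orb_def)
    then have "x = h [^] (- j) \<otimes> r x" using add[OF that] that by simp
    then show ?thesis by blast
  qed
  then obtain c :: "'a \<Rightarrow> int" where c: "\<And>x. x \<in> carrier G \<Longrightarrow> x = h [^] c x \<otimes> r x" by metis
  have rK: "r x \<in> K" if "x \<in> K" for x using r_orb[OF KG[OF that]] hK[OF that] by (auto simp: orb_def)
  have rr: "r (r x) = r x" if "x \<in> K" for x
    using r_shift[OF KG[OF rK[OF that]], of "c x"] c[OF KG[OF that]] by simp
  define T where "T = r ` K"
  have TK: "t \<in> K" if "t \<in> T" for t using that rK by (auto simp: T_def)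
  have rT: "r t = t" if "t \<in> T" for t using that rr by (auto simp: T_def)
  have "T \<subseteq> r ` F"
  proof
    fix t assume "t \<in> T"
    then obtain x where x: "x \<in> K" "t = r x" by (auto simp: T_def)
    then obtain j :: int and z where z: "z \<in> F" "x = h [^] j \<otimes> z" using F(3) by blast
    then have "t = r z" using x(2) r_shift[of z j] F(2) by auto
    then show "t \<in> r ` F" using z(1) by blast
  qed
  then have finT: "finite T" using F(1) finite_subset by blast
  define \<Phi> where "\<Phi> x = (\<Sum>t\<in>T. c (t \<otimes> x))" for x
  have perm: "bij_betw (\<lambda>t. r (t \<otimes> x)) T T" if x: "x \<in> K" for x
  proof -
    have maps: "(\<lambda>t. r (t \<otimes> x)) ` T \<subseteq> T" using TK x K by (auto simp: T_def subgroup.m_closed)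
    have "inj_on (\<lambda>t. r (t \<otimes> x)) T"
    proof (rule inj_onI)
      fix s t assume st: "s \<in> T" "t \<in> T" "r (s \<otimes> x) = r (t \<otimes> x)"
      have G: "s \<in> carrier G" "t \<in> carrier G" "x \<in> carrier G" using st TK KG x by auto
      have "s \<otimes> x = h [^] c (s \<otimes> x) \<otimes> r (t \<otimes> x)" using c[of "s \<otimes> x"] st(3) G by simp
      also have "r (t \<otimes> x) = h [^] (- c (t \<otimes> x)) \<otimes> (t \<otimes> x)"
        using arg_cong[OF c[of "t \<otimes> x"], of "\<lambda>y. h [^] (- c (t \<otimes> x)) \<otimes> y"] add[OF KG[OF rK[of "t \<otimes> x"]]]
          G rK TK st x K KG by (simp add: subgroup.m_closed)
      finally have "s \<otimes> x = h [^] (c (s \<otimes> x) - c (t \<otimes> x)) \<otimes> t \<otimes> x"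
        using add[of "t \<otimes> x"] G hG by (simp add: m_assoc)
      then have "s = h [^] (c (s \<otimes> x) - c (t \<otimes> x)) \<otimes> t" using G hG by simp
      then have "r s = r t" using r_shift[OF G(2)] by metis
      then show "s = t" using rT st by simp
    qed
    then show ?thesis using endo_inj_surj[OF finT maps] by (simp add: bij_betw_def)
  qed
  have cocycle: "c (t \<otimes> (x \<otimes> y)) = c (t \<otimes> x) + c (r (t \<otimes> x) \<otimes> y)" if "t \<in> T" "x \<in> K" "y \<in> K" for t x y
  proof -
    have tx: "t \<otimes> x \<in> K" using that TK K by (simp add: subgroup.m_closed)
    have G: "t \<in> carrier G" "x \<in> carrier G" "y \<in> carrier G" "r (t \<otimes> x) \<in> carrier G"
      using that TK KG rK[OF tx] by auto
    let ?z = "r (t \<otimes> x) \<otimes> y"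
    have rz: "r ?z \<in> carrier G" using rK[of ?z] rK[OF tx] that K KG by (simp add: subgroup.m_closed)
    have e: "t \<otimes> (x \<otimes> y) = h [^] c (t \<otimes> x) \<otimes> ?z"
      using arg_cong[OF c[of "t \<otimes> x"], of "\<lambda>w. w \<otimes> y"] G hG by (simp add: m_assoc)
    then have "r (t \<otimes> (x \<otimes> y)) = r ?z" using r_shift[of ?z] G by simp
    then have "t \<otimes> (x \<otimes> y) = h [^] c (t \<otimes> (x \<otimes> y)) \<otimes> r ?z" using c[of "t \<otimes> (x \<otimes> y)"] G by simp
    moreover have "t \<otimes> (x \<otimes> y) = h [^] (c (t \<otimes> x) + c ?z) \<otimes> r ?z"
      using e arg_cong[OF c[of ?z], of "\<lambda>w. h [^] c (t \<otimes> x) \<otimes> w"] add[OF rz] G by simp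
    ultimately show ?thesis using exponent[OF _ rz] by metis
  qed
  have "\<Phi> (x \<otimes> y) = \<Phi> x + \<Phi> y" if "x \<in> K" "y \<in> K" for x y
  proof -
    have "\<Phi> (x \<otimes> y) = (\<Sum>t\<in>T. c (t \<otimes> x) + c (r (t \<otimes> x) \<otimes> y))"
      unfolding \<Phi>_def using cocycle that by (intro sum.cong) auto
    also have "\<dots> = \<Phi> x + (\<Sum>t\<in>T. c (r (t \<otimes> x) \<otimes> y))" by (simp add: sum.distrib \<Phi>_def)
    also have "(\<Sum>t\<in>T. c (r (t \<otimes> x) \<otimes> y)) = \<Phi> y"
      unfolding \<Phi>_def using sum.reindex_bij_betw[OF perm[OF that(1)], of "\<lambda>t. c (t \<otimes> y)"] .
    finally show ?thesis .
  qed
  moreover have "c (t \<otimes> h) = 1" if t: "t \<in> T" for t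
  proof -
    have G: "t \<in> carrier G" using TK KG t by simp
    have e: "t \<otimes> h = h [^] (1::int) \<otimes> t" using central[OF TK[OF t]] hG by simp
    have "h [^] (1::int) \<otimes> t = h [^] c (t \<otimes> h) \<otimes> t"
      using c[of "t \<otimes> h"] r_shift[OF G, of 1] rT[OF t] G hG e by simp
    then show ?thesis using exponent[OF _ G] by metis
  qed
  then have "\<Phi> h = int (card T)" by (simp add: \<Phi>_def)
  moreover have "T \<noteq> {}" using h(1) by (auto simp: T_def)
  then have "0 < card T" using finT by (simp add: card_gt_0_iff)
  ultimately show thesis by (intro that[of \<Phi>]) simp_all
qed

text \<open>Two powers of \<open>x\<close> have the same representative in \<open>F\<close>; their quotient is a power of \<open>h\<close>.\<close>

lemma power_in_cyclic:
  assumes h: "h \<in> carrier G" and x: "x \<in> carrier G"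
    and F: "finite F" "F \<subseteq> carrier G" "\<And>n::nat. \<exists>j::int. \<exists>z\<in>F. x [^] n = h [^] j \<otimes> z"
  shows "\<exists>q::nat. 0 < q \<and> (\<exists>p::int. x [^] q = h [^] p)"
proof -
  obtain j :: "nat \<Rightarrow> int" and z where z: "\<And>n. z n \<in> F" "\<And>n. x [^] n = h [^] j n \<otimes> z n"
    using F(3) by metis
  have "\<not> inj z"
  proof
    assume "inj z"
    then have "finite (UNIV :: nat set)" using z(1) F(1) by (metis finite_imageD finite_subset image_subsetI)
    then show False by simp
  qed
  then obtain m n where mn: "m < n" "z m = z n" unfolding inj_def by (metis linorder_neqE_nat)
  have zG: "z n \<in> carrier G" using z(1) F(2) by blast
  have "x [^] (n - m) \<otimes> x [^] m = x [^] n" using mn x by (simp add: nat_pow_mult)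
  then have "x [^] (n - m) \<otimes> h [^] j m \<otimes> z n = h [^] j n \<otimes> z n"
    using z(2)[of m] z(2)[of n] mn x h zG by (simp add: m_assoc)
  then have "x [^] (n - m) \<otimes> h [^] j m = h [^] j n" using x h zG by simp
  then have "x [^] (n - m) = h [^] j n \<otimes> inv (h [^] j m)" using x h by (metis int_pow_closed inv_solve_right nat_pow_closed)
  then have "x [^] (n - m) = h [^] (j n - j m)" using h by (simp add: int_pow_diff)
  then show ?thesis using mn(1) by (intro exI[of _ "n - m"]) auto
qed

end

section \<open>Quotients of rank one\<close>

lemma group_rat_group: "group rat_group"
proof (rule groupI)
  fix x assume "x \<in> carrier rat_group"
  show "\<exists>y\<in>carrier rat_group. y \<otimes>\<^bsub>rat_group\<^esub> x = \<one>\<^bsub>rat_group\<^esub>"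
    by (rule bexI[of _ "- x"]) (auto simp: rat_group_def)
qed (auto simp: rat_group_def)

context group begin

lemma rank_one_quotient:
  fixes \<phi> :: "'a \<Rightarrow> rat"
  assumes P: "subgroup P G" and add: "\<And>x y. x \<in> P \<Longrightarrow> y \<in> P \<Longrightarrow> \<phi> (x \<otimes> y) = \<phi> x + \<phi> y"
    and nz: "z \<in> P" "\<phi> z \<noteq> 0"
  shows "rank_one_abelian (G\<lparr>carrier := P\<rparr> Mod {x \<in> P. \<phi> x = 0})"
proof -
  let ?P = "G\<lparr>carrier := P\<rparr>" and ?N = "{x \<in> P. \<phi> x = 0}"
  have grp: "group ?P" using P by (rule subgroup_imp_group)
  interpret \<phi>: group_hom ?P rat_group \<phi>
    using grp group_rat_group add by (auto simp: group_hom_def group_hom_axioms_def hom_def rat_group_def)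
  have ker: "kernel ?P rat_group \<phi> = ?N" by (auto simp: kernel_def rat_group_def)
  have sub: "subgroup (\<phi> ` P) rat_group" using \<phi>.img_is_subgroup by simp
  let ?R = "rat_group\<lparr>carrier := \<phi> ` P\<rparr>"
  interpret \<psi>: group_hom ?P ?R \<phi>
    using \<phi>.induced_group_hom[OF group.subgroup_self[OF grp]] by simp
  have iso: "?P Mod ?N \<cong> ?R"
    using \<psi>.FactGroup_iso ker by (simp add: kernel_def)
  have nor: "?N \<lhd> ?P" using \<phi>.normal_kernel ker by simp
  have "group (?P Mod ?N)" using nor by (rule normal.factorgroup_is_group)
  moreover have "carrier (?P Mod ?N) \<noteq> {\<one>\<^bsub>?P Mod ?N\<^esub>}"
  proof
    assume "carrier (?P Mod ?N) = {\<one>\<^bsub>?P Mod ?N\<^esub>}"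
    then have "?N #>\<^bsub>?P\<^esub> z = ?N" using nz(1) by (auto simp: carrier_FactGroup)
    then have "z \<in> ?N"
      by (rule group.coset_join1[OF grp]) (use nz(1) normal_imp_subgroup[OF nor] in simp_all)
    then show False using nz by simp
  qed
  ultimately show ?thesis unfolding rank_one_abelian_def using sub iso by blast
qed

text \<open>The purely group-theoretic form of the dichotomy, for a homomorphism from a subgroup \<open>P\<close>
  of index at most \<open>2\<close> to the rationals whose values are inverted by conjugation with
  elements outside \<open>P\<close>. The two alternatives are \<open>P = carrier G\<close> and index exactly \<open>2\<close>.\<close>

lemma rank_one_or_by_inversion:
  fixes \<phi> :: "'a \<Rightarrow> rat"
  assumes P: "subgroup P G" and add: "\<And>x y. x \<in> P \<Longrightarrow> y \<in> P \<Longrightarrow> \<phi> (x \<otimes> y) = \<phi> x + \<phi> y"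
    and nz: "z \<in> P" "\<phi> z \<noteq> 0"
    and index2: "\<And>x y. x \<in> carrier G - P \<Longrightarrow> y \<in> carrier G - P \<Longrightarrow> x \<otimes> y \<in> P"
    and invert: "\<And>x a. x \<in> carrier G - P \<Longrightarrow> a \<in> P \<Longrightarrow> x \<otimes> a \<otimes> inv x \<in> P \<and> \<phi> (x \<otimes> a \<otimes> inv x) = - \<phi> a"
  defines "N \<equiv> {x \<in> P. \<phi> x = 0}"
  shows "N \<lhd> G" "rank_one_abelian (G Mod N) \<or> rank_one_by_inversion (G Mod N)"
proof -
  have PG: "x \<in> carrier G" if "x \<in> P" for x using subgroup.subset[OF P] that by blast
  note [simp] = subgroup.m_closed[OF P] subgroup.m_inv_closed[OF P] subgroup.one_closed[OF P] PG
  have \<phi>1: "\<phi> \<one> = 0" using add[of \<one> \<one>] by simp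
  have \<phi>inv: "\<phi> (inv x) = - \<phi> x" if "x \<in> P" for x using add[of x "inv x"] that \<phi>1 by simp
  show nor: "N \<lhd> G"
  proof (rule normal_invI)
    show "subgroup N G"
      by (rule subgroupI) (auto simp: N_def add \<phi>inv \<phi>1 intro!: exI[of _ \<one>])
    fix x a assume x: "x \<in> carrier G" and a: "a \<in> N"
    show "x \<otimes> a \<otimes> inv x \<in> N"
    proof (cases "x \<in> P")
      case True then show ?thesis using a by (simp add: N_def add \<phi>inv)
    next
      case False then show ?thesis using invert[of x a] x a by (simp add: N_def)
    qed
  qed
  interpret N: normal N G by (rule nor)
  let ?Q = "G Mod N" and ?\<pi> = "\<lambda>x. N #> x"
  have grpQ: "group ?Q" by (rule N.factorgroup_is_group)
  interpret \<pi>: group_hom G ?Q ?\<pi>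
    using grpQ N.r_coset_hom_Mod by (simp add: group_hom_def group_hom_axioms_def is_group)
  \<comment> \<open>The quotient of \<open>P\<close> is literally a subgroup of the quotient of \<open>G\<close>, as cosets
    and their product do not refer to the carrier.\<close>
  have restrict: "G\<lparr>carrier := P\<rparr> Mod N = ?Q\<lparr>carrier := ?\<pi> ` P\<rparr>"
    by (auto simp: FactGroup_def RCOSETS_def r_coset_def set_mult_def fun_eq_iff)
  have rank1: "rank_one_abelian (?Q\<lparr>carrier := ?\<pi> ` P\<rparr>)"
    using rank_one_quotient[OF P add nz] restrict by (simp add: N_def)
  show "rank_one_abelian ?Q \<or> rank_one_by_inversion ?Q"
  proof (cases "P = carrier G")
    case True
    then have "?\<pi> ` P = carrier ?Q" by (simp add: carrier_FactGroup)
    then show ?thesis using rank1 by simp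
  next
    case False
    then obtain x0 where x0: "x0 \<in> carrier G - P" using PG by blast
    let ?A = "?\<pi> ` P"
    have A: "subgroup ?A ?Q" using \<pi>.subgroup_img_is_subgroup[OF P] .
    have member: "x \<in> P" if "?\<pi> x \<in> ?A" "x \<in> carrier G" for x
    proof -
      have x: "x \<in> N #> x" using rcos_self[OF that(2) N.subgroup_axioms] .
      from that(1) obtain a where a: "a \<in> P" "?\<pi> x = ?\<pi> a" by blast
      then have "x \<in> N #> a" using x by simp
      then show ?thesis using a(1) by (auto simp: r_coset_def N_def)
    qed
    have inv_out: "inv x \<in> carrier G - P" if "x \<in> carrier G - P" for x
      using that subgroup.m_inv_closed[OF P, of "inv x"] by auto
    have x0Q: "?\<pi> x0 \<in> carrier ?Q" using x0 by (simp add: carrier_FactGroup)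
    have coset: "?A #>\<^bsub>?Q\<^esub> ?\<pi> x = (if x \<in> P then ?A else ?A #>\<^bsub>?Q\<^esub> ?\<pi> x0)" if x: "x \<in> carrier G" for x
    proof (cases "x \<in> P")
      case True
      then show ?thesis using group.coset_join2[OF grpQ _ A] by (simp add: carrier_FactGroup)
    next
      case False
      have "x \<otimes> inv x0 \<in> P" using index2 inv_out[OF x0] x False by simp
      then have "?\<pi> (x \<otimes> inv x0) \<otimes>\<^bsub>?Q\<^esub> ?\<pi> x0 \<in> ?A #>\<^bsub>?Q\<^esub> ?\<pi> x0" unfolding r_coset_def by blast
      moreover have "?\<pi> (x \<otimes> inv x0) \<otimes>\<^bsub>?Q\<^esub> ?\<pi> x0 = ?\<pi> x"
        using \<pi>.hom_mult[of "x \<otimes> inv x0" x0] x x0 by (simp add: m_assoc)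
      ultimately have "?\<pi> x \<in> ?A #>\<^bsub>?Q\<^esub> ?\<pi> x0" by simp
      then show ?thesis using group.repr_independence[OF grpQ _ x0Q A] False by simp
    qed
    have ne: "?A \<noteq> ?A #>\<^bsub>?Q\<^esub> ?\<pi> x0"
      using group.coset_join1[OF grpQ _ x0Q A] member[of x0] x0 by auto
    have "rcosets\<^bsub>?Q\<^esub> ?A = (\<lambda>x. ?A #>\<^bsub>?Q\<^esub> ?\<pi> x) ` carrier G"
      by (auto simp: RCOSETS_def carrier_FactGroup)
    also have "\<dots> = {?A, ?A #>\<^bsub>?Q\<^esub> ?\<pi> x0}"
    proof
      show "(\<lambda>x. ?A #>\<^bsub>?Q\<^esub> ?\<pi> x) ` carrier G \<subseteq> {?A, ?A #>\<^bsub>?Q\<^esub> ?\<pi> x0}" using coset by auto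
      have "?A \<in> (\<lambda>x. ?A #>\<^bsub>?Q\<^esub> ?\<pi> x) ` carrier G"
        using coset[of \<one>] by (intro image_eqI[of _ _ \<one>]) simp_all
      then show "{?A, ?A #>\<^bsub>?Q\<^esub> ?\<pi> x0} \<subseteq> (\<lambda>x. ?A #>\<^bsub>?Q\<^esub> ?\<pi> x) ` carrier G" using x0 by blast
    qed
    finally have card: "card (rcosets\<^bsub>?Q\<^esub> ?A) = 2" using ne by simp
    have "X \<otimes>\<^bsub>?Q\<^esub> a \<otimes>\<^bsub>?Q\<^esub> inv\<^bsub>?Q\<^esub> X = inv\<^bsub>?Q\<^esub> a" if Xa: "X \<in> carrier ?Q - ?A" "a \<in> ?A" for X a
    proof -
      obtain x where x: "x \<in> carrier G" "X = ?\<pi> x" using Xa(1) by (auto simp: carrier_FactGroup)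
      then have xP: "x \<in> carrier G - P" using Xa(1) by auto
      obtain b where b: "b \<in> P" "a = ?\<pi> b" using Xa(2) by blast
      let ?c = "x \<otimes> b \<otimes> inv x"
      have c: "?c \<in> P" "\<phi> ?c = - \<phi> b" using invert[OF xP b(1)] by auto
      have "X \<otimes>\<^bsub>?Q\<^esub> a \<otimes>\<^bsub>?Q\<^esub> inv\<^bsub>?Q\<^esub> X = ?\<pi> ?c"
        using x b(1) PG[OF b(1)] unfolding x(2) b(2) by (simp only: \<pi>.hom_mult \<pi>.hom_inv m_closed inv_closed)
      also have "\<dots> = ?\<pi> (inv b)"
      proof -
        have "?c \<otimes> b \<in> N" using c b(1) by (simp add: N_def add)
        then have "?c \<otimes> b \<otimes> inv b \<in> N #> inv b" unfolding r_coset_def by blast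
        also have "?c \<otimes> b \<otimes> inv b = ?c" using x b(1) by (simp add: m_assoc)
        finally have "?c \<in> N #> inv b" .
        moreover have "inv b \<in> carrier G" using b(1) by simp
        ultimately show ?thesis by (rule repr_independence[OF _ _ N.subgroup_axioms, symmetric])
      qed
      also have "\<dots> = inv\<^bsub>?Q\<^esub> a" using b PG[OF b(1)] by (simp only: \<pi>.hom_inv)
      finally show ?thesis .
    qed
    then show ?thesis unfolding rank_one_by_inversion_def using A card rank1 by blast
  qed
qed

end

section \<open>Elements commensurating a cyclic group\<close>

context group begin

text \<open>With the sign as a parameter, the two cases in the definition of \<open>EL G g\<close> are handled at
  once: signs multiply under products.\<close>

definition acts_on_power :: "'a \<Rightarrow> 'a \<Rightarrow> int \<Rightarrow> bool" where
  "acts_on_power g x \<epsilon> \<longleftrightarrow> (\<exists>n::nat. 0 < n \<and> x \<otimes> g [^] int n \<otimes> inv x = g [^] (\<epsilon> * int n))"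

lemma EL_iff_acts_on_power:
  "EL G g = {x \<in> carrier G. acts_on_power g x 1 \<or> acts_on_power g x (-1)}"
  unfolding EL_def acts_on_power_def by (auto simp: int_pow_int)

lemma conj_int_pow:
  assumes "x \<in> carrier G" "a \<in> carrier G"
  shows "x \<otimes> a [^] (k::int) \<otimes> inv x = (x \<otimes> a \<otimes> inv x) [^] k"
proof -
  have "(\<lambda>a. x \<otimes> a \<otimes> inv x) \<in> hom G G"
    using assms(1) by (auto simp: hom_def m_assoc)
  from hom_int_pow[OF this assms(2) is_group is_group] show ?thesis .
qed

lemma acts_on_power_one: "g \<in> carrier G \<Longrightarrow> acts_on_power g \<one> 1"
  unfolding acts_on_power_def by (intro exI[of _ 1]) simp

lemma acts_on_power_mult:
  assumes g: "g \<in> carrier G" and c: "x \<in> carrier G" "y \<in> carrier G"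
    and x: "acts_on_power g x \<epsilon>" and y: "acts_on_power g y \<delta>"
  shows "acts_on_power g (x \<otimes> y) (\<epsilon> * \<delta>)"
proof -
  obtain n m :: nat where n: "0 < n" "x \<otimes> g [^] int n \<otimes> inv x = g [^] (\<epsilon> * int n)"
    and m: "0 < m" "y \<otimes> g [^] int m \<otimes> inv y = g [^] (\<delta> * int m)"
    using x y unfolding acts_on_power_def by blast
  have "y \<otimes> g [^] int (n * m) \<otimes> inv y = (y \<otimes> g [^] int m \<otimes> inv y) [^] int n"
    using conj_int_pow[of y "g [^] int m" "int n"] g c by (simp add: int_pow_pow mult.commute)
  also have "\<dots> = (g [^] int n) [^] (\<delta> * int m)" using g by (simp add: m int_pow_pow ac_simps)
  finally have "x \<otimes> (y \<otimes> g [^] int (n * m) \<otimes> inv y) \<otimes> inv x = (x \<otimes> g [^] int n \<otimes> inv x) [^] (\<delta> * int m)"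
    using conj_int_pow[of x "g [^] int n" "\<delta> * int m"] g c by simp
  also have "\<dots> = g [^] (\<epsilon> * \<delta> * int (n * m))" using g by (simp add: n int_pow_pow ac_simps)
  finally have "(x \<otimes> y) \<otimes> g [^] int (n * m) \<otimes> inv (x \<otimes> y) = g [^] (\<epsilon> * \<delta> * int (n * m))"
    using g c by (simp add: inv_mult_group m_assoc)
  then show ?thesis unfolding acts_on_power_def using n m by (intro exI[of _ "n * m"]) simp
qed

lemma acts_on_power_inv:
  assumes g: "g \<in> carrier G" and x: "x \<in> carrier G" "acts_on_power g x \<epsilon>" and \<epsilon>: "\<epsilon> * \<epsilon> = 1"
  shows "acts_on_power g (inv x) \<epsilon>"
proof -
  obtain n :: nat where n: "0 < n" "x \<otimes> g [^] int n \<otimes> inv x = g [^] (\<epsilon> * int n)"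
    using x(2) unfolding acts_on_power_def by blast
  have "x \<otimes> g [^] (\<epsilon> * int n) \<otimes> inv x = (x \<otimes> g [^] int n \<otimes> inv x) [^] \<epsilon>"
    using conj_int_pow[of x "g [^] int n" \<epsilon>] g x by (simp add: int_pow_pow mult.commute)
  also have "\<dots> = g [^] (\<epsilon> * \<epsilon> * int n)" using g by (simp add: n int_pow_pow ac_simps)
  finally have e: "x \<otimes> g [^] (\<epsilon> * int n) \<otimes> inv x = g [^] int n" by (simp add: \<epsilon>)
  have "inv x \<otimes> g [^] int n \<otimes> inv (inv x) = g [^] (\<epsilon> * int n)"
    using g x(1) by (simp add: e[symmetric] m_assoc)
  then show ?thesis unfolding acts_on_power_def using n(1) by blast
qed

lemma subgroup_EL:
  assumes g: "g \<in> carrier G"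
  shows "subgroup (EL G g) G"
proof (rule subgroupI)
  show "EL G g \<noteq> {}" using acts_on_power_one[OF g] by (auto simp: EL_iff_acts_on_power)
  show "inv x \<in> EL G g" if "x \<in> EL G g" for x
    using that acts_on_power_inv[OF g] by (auto simp: EL_iff_acts_on_power)
  show "x \<otimes> y \<in> EL G g" if "x \<in> EL G g" "y \<in> EL G g" for x y
    using that acts_on_power_mult[OF g, of x y] by (fastforce simp: EL_iff_acts_on_power)
qed (auto simp: EL_iff_acts_on_power)

definition power_centralizer :: "'a \<Rightarrow> 'a set" where
  "power_centralizer g = {x \<in> carrier G. acts_on_power g x 1}"

lemma power_centralizer_subset_EL: "power_centralizer g \<subseteq> EL G g"
  by (auto simp: power_centralizer_def EL_iff_acts_on_power)

lemma subgroup_power_centralizer: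
  assumes g: "g \<in> carrier G"
  shows "subgroup (power_centralizer g) G"
proof (rule subgroupI)
  show "power_centralizer g \<noteq> {}" using acts_on_power_one[OF g] by (auto simp: power_centralizer_def)
  show "inv x \<in> power_centralizer g" if "x \<in> power_centralizer g" for x
    using that acts_on_power_inv[OF g] by (auto simp: power_centralizer_def)
  show "x \<otimes> y \<in> power_centralizer g" if "x \<in> power_centralizer g" "y \<in> power_centralizer g" for x y
    using that acts_on_power_mult[OF g, of x y 1 1] by (auto simp: power_centralizer_def)
qed (auto simp: power_centralizer_def)

lemma power_centralizer_commutes:
  assumes "g \<in> carrier G" "x \<in> power_centralizer g"
  shows "\<exists>n::nat. 0 < n \<and> x \<otimes> g [^] n = g [^] n \<otimes> x"
proof -
  obtain n :: nat where n: "0 < n" "x \<otimes> g [^] n \<otimes> inv x = g [^] n" and x: "x \<in> carrier G"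
    using assms(2) by (auto simp: power_centralizer_def acts_on_power_def int_pow_int)
  have "x \<otimes> g [^] n = x \<otimes> g [^] n \<otimes> inv x \<otimes> x" using assms(1) x by (simp add: m_assoc)
  then show ?thesis using n by auto
qed

text \<open>The product of the exponents for the single elements works for all of them.\<close>

lemma common_commuting_power:
  assumes g: "g \<in> carrier G" and S: "finite S" "S \<subseteq> power_centralizer g"
  shows "\<exists>n::nat. 0 < n \<and> (\<forall>s\<in>S. s \<otimes> g [^] n = g [^] n \<otimes> s)"
  using S
proof (induction S rule: finite_induct)
  case (insert x S)
  then obtain n :: nat where n: "0 < n" "\<forall>s\<in>S. s \<otimes> g [^] n = g [^] n \<otimes> s" by auto
  obtain m :: nat where m: "0 < m" "x \<otimes> g [^] m = g [^] m \<otimes> x"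
    using power_centralizer_commutes[OF g] insert.prems by blast
  have mult: "s \<otimes> g [^] (i * j) = g [^] (i * j) \<otimes> s"
    if "s \<in> carrier G" "s \<otimes> g [^] i = g [^] i \<otimes> s" for s and i j :: nat
    using commutes_pow[of s "g [^] i" "int j"] that g by (simp add: int_pow_int nat_pow_pow)
  have "s \<in> carrier G" if "s \<in> insert x S" for s using that insert.prems by (auto simp: power_centralizer_def)
  then have "\<forall>s\<in>insert x S. s \<otimes> g [^] (n * m) = g [^] (n * m) \<otimes> s"
    using mult[of _ n m] mult[of _ m n] n(2) m(2) by (auto simp: mult.commute)
  then show ?case using n m by (intro exI[of _ "n * m"]) simp
qed auto

text \<open>The choice is unique when \<open>g\<close> has infinite order, by \<open>slope_eq\<close> below.\<close>
definition slope :: "'a \<Rightarrow> 'a \<Rightarrow> rat" where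
  "slope g x = (SOME r. \<exists>q::nat. \<exists>p::int. 0 < q \<and> x [^] q = g [^] p \<and> r = of_int p / of_nat q)"

lemma slope_eq:
  assumes g: "g \<in> carrier G" "\<And>n::nat. n > 0 \<Longrightarrow> g [^] n \<noteq> \<one>"
    and x: "x \<in> carrier G" and q: "0 < (q::nat)" "x [^] q = g [^] (p::int)"
  shows "slope g x = of_int p / of_nat q"
  unfolding slope_def
proof (rule some_equality)
  show "\<exists>q'::nat. \<exists>p'::int. 0 < q' \<and> x [^] q' = g [^] p' \<and> (of_int p / of_nat q :: rat) = of_int p' / of_nat q'"
    using q by blast
next
  fix r :: rat
  assume "\<exists>q::nat. \<exists>p::int. 0 < q \<and> x [^] q = g [^] p \<and> r = of_int p / of_nat q"
  then obtain q' :: nat and p' :: int where q': "0 < q'" "x [^] q' = g [^] p'" and r: "r = of_int p' / of_nat q'"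
    by blast
  have "g [^] (p * int q') = (g [^] p) [^] int q'" using g(1) by (simp add: int_pow_pow)
  also have "\<dots> = (x [^] q) [^] q'" by (simp only: q(2) int_pow_int)
  also have "\<dots> = (x [^] q') [^] q" using x by (simp add: nat_pow_pow mult.commute)
  also have "\<dots> = (g [^] p') [^] int q" by (simp only: q'(2) int_pow_int)
  also have "\<dots> = g [^] (p' * int q)" using g(1) by (simp add: int_pow_pow)
  finally have "p * int q' = p' * int q" using inj_int_pow[OF g] by (simp add: inj_def)
  then have "(of_int p * of_nat q' :: rat) = of_int p' * of_nat q"
    by (metis of_int_mult of_int_of_nat_eq)
  then show "r = of_int p / of_nat q" unfolding r using q(1) q'(1) by (simp add: frac_eq_eq)
qed

end

text \<open>The geometric input to the algebra: finitely generated subgroups of centralizers of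
  powers of \<open>g\<close> are virtually cyclic.\<close>

locale virtually_cyclic_power_centralizers = group G for G (structure) +
  fixes g :: 'a
  assumes g: "g \<in> carrier G" and infinite_order: "\<And>n::nat. n > 0 \<Longrightarrow> g [^] n \<noteq> \<one>"
    and finite_modulo_power: "\<And>(n::nat) S. 0 < n \<Longrightarrow> finite S \<Longrightarrow> S \<subseteq> carrier G \<Longrightarrow>
      (\<And>s. s \<in> S \<Longrightarrow> s \<otimes> g [^] n = g [^] n \<otimes> s) \<Longrightarrow>
      \<exists>F\<subseteq>carrier G. finite F \<and> (\<forall>y\<in>generate G S. \<exists>j::int. \<exists>z\<in>F. y = (g [^] n) [^] j \<otimes> z)"
begin

text \<open>Adjoining a central power \<open>h = g [^] n\<close> to \<open>S\<close> gives a group in which \<open>\<langle>h\<rangle>\<close> has finite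
  index. A relation \<open>x [^] q = h [^] p\<close> forces \<open>q * \<Phi> x = p * \<Phi> h\<close> for the transfer \<open>\<Phi>\<close>,
  so \<open>\<Phi>\<close> computes slopes up to the factor \<open>n / \<Phi> h\<close>.\<close>

lemma slope_proportional_to_hom:
  assumes S: "finite S" "S \<subseteq> power_centralizer g"
  obtains \<Phi> :: "'a \<Rightarrow> int" and c :: rat where
    "\<And>x y. x \<in> generate G S \<Longrightarrow> y \<in> generate G S \<Longrightarrow> \<Phi> (x \<otimes> y) = \<Phi> x + \<Phi> y"
    "\<And>x. x \<in> generate G S \<Longrightarrow> slope g x = c * of_int (\<Phi> x)"
proof -
  have SG: "S \<subseteq> carrier G" using S(2) by (auto simp: power_centralizer_def)
  obtain n :: nat where n: "0 < n" and comm: "\<And>s. s \<in> S \<Longrightarrow> s \<otimes> g [^] n = g [^] n \<otimes> s"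
    using common_commuting_power[OF g S] by blast
  define h where "h = g [^] n"
  have h: "h \<in> carrier G" using g by (simp add: h_def)
  have hinf: "h [^] k \<noteq> \<one>" if "k > 0" for k :: nat
    using infinite_order[of "n * k"] n that g by (simp add: h_def nat_pow_pow)
  have commT: "s \<otimes> g [^] n = g [^] n \<otimes> s" if "s \<in> insert h S" for s
    using that comm by (auto simp only: h_def insert_iff)
  let ?K = "generate G (insert h S)"
  have TG: "insert h S \<subseteq> carrier G" using SG h by simp
  have K: "subgroup ?K G" using TG by (rule generate_is_subgroup)
  have KG: "x \<in> carrier G" if "x \<in> ?K" for x using subgroup.subset[OF K] that by blast
  have hK: "h \<in> ?K" by (rule generate.incl) simp
  have central: "x \<otimes> h = h \<otimes> x" if "x \<in> ?K" for x
    using that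
  proof (induction rule: generate.induct)
    case one
    then show ?case using h by simp
  next
    case (incl s)
    then show ?case using commT unfolding h_def by blast
  next
    case (inv s)
    then show ?case using commutes_inv[of s h] commT[of s] h TG unfolding h_def by (metis subsetD)
  next
    case (eng x y)
    then show ?case using commutes_mult[OF KG KG h, of x y] by simp
  qed
  obtain F where F: "F \<subseteq> carrier G" "finite F" "\<forall>y\<in>?K. \<exists>j::int. \<exists>z\<in>F. y = h [^] j \<otimes> z"
    using finite_modulo_power[OF n _ TG commT] S(1) unfolding h_def by blast
  obtain \<Phi> :: "'a \<Rightarrow> int" where \<Phi>: "\<And>x y. x \<in> ?K \<Longrightarrow> y \<in> ?K \<Longrightarrow> \<Phi> (x \<otimes> y) = \<Phi> x + \<Phi> y" "0 < \<Phi> h"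
    using transfer_to_central_powers[OF K hK hinf central F(2,1)] F(3) by metis
  have \<Phi>1: "\<Phi> \<one> = 0" using \<Phi>(1)[of \<one> \<one>] subgroup.one_closed[OF K] by simp
  have \<Phi>inv: "\<Phi> (inv x) = - \<Phi> x" if "x \<in> ?K" for x
    using \<Phi>(1)[of x "inv x"] \<Phi>1 that subgroup.m_inv_closed[OF K] KG by simp
  have powK: "x [^] k \<in> ?K" if "x \<in> ?K" for x and k :: nat
    using that by (induction k) (auto simp: subgroup.one_closed[OF K] subgroup.m_closed[OF K])
  have \<Phi>pow: "\<Phi> (x [^] k) = int k * \<Phi> x" if "x \<in> ?K" for x and k :: nat
    using that powK by (induction k) (auto simp: \<Phi>1 \<Phi>(1) algebra_simps)
  have \<Phi>int: "\<Phi> (h [^] k) = k * \<Phi> h" for k :: int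
  proof (cases k rule: int_cases2)
    case (nonneg i)
    then show ?thesis using \<Phi>pow[OF hK, of i] by (simp add: int_pow_int)
  next
    case (nonpos i)
    then show ?thesis using \<Phi>pow[OF hK, of i] \<Phi>inv[OF powK[OF hK], of i] h by (simp add: int_pow_neg_int)
  qed
  have slope: "slope g x = of_nat n / of_int (\<Phi> h) * of_int (\<Phi> x)" if x: "x \<in> ?K" for x
  proof -
    have "\<exists>j::int. \<exists>z\<in>F. x [^] k = h [^] j \<otimes> z" for k :: nat using F(3) powK[OF x] by blast
    from power_in_cyclic[OF h KG[OF x] F(2,1) this]
    obtain q :: nat and p :: int where q: "0 < q" "x [^] q = h [^] p" by blast
    have "x [^] q = g [^] (int n * p)" using q(2) g by (simp add: h_def int_pow_pow int_pow_int[symmetric])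
    from slope_eq[OF g infinite_order KG[OF x] q(1) this]
    have "slope g x = of_nat n * of_int p / of_nat q" by simp
    moreover have "int q * \<Phi> x = p * \<Phi> h" using \<Phi>pow[OF x, of q] \<Phi>int[of p] q(2) by simp
    then have "(of_nat q * of_int (\<Phi> x) :: rat) = of_int p * of_int (\<Phi> h)"
      by (metis of_int_mult of_int_of_nat_eq)
    then have "(of_int p :: rat) = of_nat q * of_int (\<Phi> x) / of_int (\<Phi> h)" using \<Phi>(2) by (simp add: field_simps)
    ultimately show ?thesis using q(1) by simp
  qed
  have sub: "generate G S \<subseteq> ?K" by (rule mono_generate) auto
  show thesis
    by (rule that[of \<Phi> "of_nat n / of_int (\<Phi> h)"]) (use \<Phi>(1) slope sub in auto)
qed

lemma slope_mult:
  assumes "x \<in> power_centralizer g" "y \<in> power_centralizer g"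
  shows "slope g (x \<otimes> y) = slope g x + slope g y"
proof -
  obtain \<Phi> :: "'a \<Rightarrow> int" and c :: rat where
    add: "\<And>a b. a \<in> generate G {x, y} \<Longrightarrow> b \<in> generate G {x, y} \<Longrightarrow> \<Phi> (a \<otimes> b) = \<Phi> a + \<Phi> b"
    and slope: "\<And>a. a \<in> generate G {x, y} \<Longrightarrow> slope g a = c * of_int (\<Phi> a)"
    using slope_proportional_to_hom[of "{x, y}"] assms by auto
  have xy: "x \<in> generate G {x, y}" "y \<in> generate G {x, y}" by (auto intro: generate.incl)
  then have "x \<otimes> y \<in> generate G {x, y}" by (rule generate.eng)
  then show ?thesis using slope add xy by (simp add: distrib_left)
qed

lemma power_has_power:
  assumes x: "x \<in> power_centralizer g"
  shows "\<exists>q::nat. \<exists>p::int. 0 < q \<and> x [^] q = g [^] p"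
proof -
  have xG: "x \<in> carrier G" using x by (simp add: power_centralizer_def)
  obtain n :: nat where n: "0 < n" "x \<otimes> g [^] n = g [^] n \<otimes> x"
    using power_centralizer_commutes[OF g x] by blast
  obtain F where F: "F \<subseteq> carrier G" "finite F" "\<forall>y\<in>generate G {x}. \<exists>j::int. \<exists>z\<in>F. y = (g [^] n) [^] j \<otimes> z"
    using finite_modulo_power[of n "{x}"] n xG by auto
  have "x [^] k \<in> generate G {x}" for k :: nat
    by (induction k) (auto intro: generate.intros)
  then have "\<exists>j::int. \<exists>z\<in>F. x [^] k = (g [^] n) [^] j \<otimes> z" for k :: nat using F(3) by blast
  from power_in_cyclic[OF _ xG F(2,1) this]
  obtain q :: nat and p :: int where q: "0 < q" "x [^] q = (g [^] n) [^] p" using g by auto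
  have "x [^] q = g [^] (int n * p)" using q(2) g by (simp add: int_pow_pow int_pow_int[symmetric])
  then show ?thesis using q(1) by blast
qed

lemma slope_power: "slope g (g [^] (k::int)) = of_int k"
  using slope_eq[OF g infinite_order, of "g [^] k" 1 k] g by simp

lemma g_pow_in_centralizer: "g [^] (k::int) \<in> power_centralizer g"
proof -
  have "g \<in> power_centralizer g"
    using g unfolding power_centralizer_def acts_on_power_def by (auto simp: m_assoc intro!: exI[of _ 1])
  then show ?thesis by (rule subgroup_int_pow_closed[OF subgroup_power_centralizer[OF g]])
qed

text \<open>The slope of \<open>x\<close> vanishes iff \<open>x\<close> has finite order.\<close>

definition torsion :: "'a set" where
  "torsion = {x \<in> power_centralizer g. slope g x = 0}"

text \<open>Finitely many cosets of \<open>\<langle>g\<rangle>\<close> cover the generated group, and each coset contains at most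
  one element of slope \<open>0\<close>, since multiplication by \<open>g [^] k\<close> adds \<open>k\<close> to the slope.\<close>

lemma finite_generate_torsion:
  assumes S: "finite S" "S \<subseteq> torsion"
  shows "finite (generate G S)"
proof -
  have SC: "S \<subseteq> power_centralizer g" and S0: "\<And>s. s \<in> S \<Longrightarrow> slope g s = 0" using S(2) by (auto simp: torsion_def)
  have SG: "S \<subseteq> carrier G" using SC by (auto simp: power_centralizer_def)
  have one: "slope g \<one> = 0" using slope_power[of 0] by simp
  have genC: "generate G S \<subseteq> power_centralizer g"
    by (rule generate_subgroup_incl[OF SC subgroup_power_centralizer[OF g]])
  have C: "subgroup (power_centralizer g) G" by (rule subgroup_power_centralizer[OF g])
  have zero: "slope g y = 0" if "y \<in> generate G S" for y
    using that
  proof (induction rule: generate.induct)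
    case (inv s)
    then have "s \<in> power_centralizer g" "s \<in> carrier G" using SC SG by auto
    then show ?case using slope_mult[of s "inv s"] one S0[OF inv] subgroup.m_inv_closed[OF C] by simp
  next
    case (eng x y)
    then show ?case using slope_mult genC by (simp add: subset_iff)
  qed (simp_all add: one S0)
  obtain n :: nat where n: "0 < n" and comm: "\<And>s. s \<in> S \<Longrightarrow> s \<otimes> g [^] n = g [^] n \<otimes> s"
    using common_commuting_power[OF g S(1) SC] by blast
  obtain F where F: "F \<subseteq> carrier G" "finite F" "\<forall>y\<in>generate G S. \<exists>j::int. \<exists>z\<in>F. y = (g [^] n) [^] j \<otimes> z"
    using finite_modulo_power[OF n S(1) SG comm] by blast
  have "\<forall>y\<in>generate G S. \<exists>z. z \<in> F \<and> (\<exists>j::int. y = g [^] j \<otimes> z)"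
  proof
    fix y assume "y \<in> generate G S"
    then obtain j :: int and z where z: "z \<in> F" "y = (g [^] n) [^] j \<otimes> z" using F(3) by blast
    have "(g [^] n) [^] j = g [^] (int n * j)" using g by (simp add: int_pow_pow int_pow_int[symmetric])
    then show "\<exists>z. z \<in> F \<and> (\<exists>j::int. y = g [^] j \<otimes> z)" using z by metis
  qed
  then obtain f where f: "\<And>y. y \<in> generate G S \<Longrightarrow> f y \<in> F \<and> (\<exists>j::int. y = g [^] j \<otimes> f y)" by metis
  have "inj_on f (generate G S)"
  proof (rule inj_onI)
    fix x y assume xy: "x \<in> generate G S" "y \<in> generate G S" "f x = f y"
    then obtain i j :: int where ij: "x = g [^] i \<otimes> f y" "y = g [^] j \<otimes> f y" using f by metis
    have fG: "f y \<in> carrier G" using f[OF xy(2)] F(1) by blast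
    have "x = g [^] (i - j) \<otimes> (g [^] j \<otimes> f y)"
      using ij(1) g fG by (simp add: m_assoc[symmetric] int_pow_mult[symmetric])
    then have x: "x = g [^] (i - j) \<otimes> y" using ij(2) by simp
    have "slope g x = of_int (i - j) + slope g y"
      using slope_mult[OF g_pow_in_centralizer, of y "i - j"] slope_power[of "i - j"] genC xy(2) x by auto
    then have "i = j" using zero[OF xy(1)] zero[OF xy(2)] by (metis add.right_neutral eq_iff_diff_eq_0 of_int_eq_0_iff)
    then show "x = y" using x xy(2) generate_in_carrier[OF SG] by simp
  qed
  moreover have "f ` generate G S \<subseteq> F" using f by blast
  ultimately show ?thesis using F(2) by (rule inj_on_finite)
qed

text \<open>If \<open>a [^] q = g [^] p\<close> and \<open>x\<close> inverts \<open>g [^] n\<close>, then conjugating \<open>a [^] (q * n) = g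
  [^] (p * n)\<close> by \<open>x\<close> changes the sign of \<open>p\<close>.\<close>

lemma slope_conj_inverted:
  assumes x: "x \<in> carrier G" "acts_on_power g x (-1)" and a: "a \<in> power_centralizer g"
  shows "x \<otimes> a \<otimes> inv x \<in> power_centralizer g" "slope g (x \<otimes> a \<otimes> inv x) = - slope g a"
proof -
  have aG: "a \<in> carrier G" "acts_on_power g a 1" using a by (auto simp: power_centralizer_def)
  have "acts_on_power g (x \<otimes> a \<otimes> inv x) ((-1 * 1) * -1)"
    using x aG g by (intro acts_on_power_mult acts_on_power_inv) auto
  then show "x \<otimes> a \<otimes> inv x \<in> power_centralizer g" using x aG by (simp add: power_centralizer_def)
  obtain n :: nat where n: "0 < n" "x \<otimes> g [^] int n \<otimes> inv x = g [^] (-1 * int n)"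
    using x(2) unfolding acts_on_power_def by blast
  obtain q :: nat and p :: int where q: "0 < q" "a [^] q = g [^] p" using power_has_power[OF a] by blast
  have "(x \<otimes> a \<otimes> inv x) [^] (q * n) = x \<otimes> a [^] int (q * n) \<otimes> inv x"
    using conj_int_pow[OF x(1) aG(1), of "int (q * n)"] by (simp only: int_pow_int)
  also have "a [^] int (q * n) = (a [^] q) [^] int n" using aG by (simp add: int_pow_int nat_pow_pow del: of_nat_mult)
  also have "\<dots> = (g [^] int n) [^] p" using g by (simp add: q(2) int_pow_pow mult.commute)
  also have "x \<otimes> (g [^] int n) [^] p \<otimes> inv x = g [^] (- (int n * p))"
    using conj_int_pow[OF x(1), of "g [^] int n" p] g n(2) by (simp add: int_pow_pow)
  finally have "(x \<otimes> a \<otimes> inv x) [^] (q * n) = g [^] (- (int n * p))" .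
  from slope_eq[OF g infinite_order _ _ this]
  have "slope g (x \<otimes> a \<otimes> inv x) = of_int (- (int n * p)) / of_nat (q * n)" using x(1) aG n(1) q(1) by simp
  also have "\<dots> = - (of_int p / of_nat q)" using n(1) by simp
  also have "of_int p / of_nat q = slope g a" using slope_eq[OF g infinite_order aG(1) q] by simp
  finally show "slope g (x \<otimes> a \<otimes> inv x) = - slope g a" .
qed

theorem EL_structure:
  "torsion \<lhd> G\<lparr>carrier := EL G g\<rparr> \<and> locally_finite (G\<lparr>carrier := torsion\<rparr>) \<and>
   (rank_one_abelian (G\<lparr>carrier := EL G g\<rparr> Mod torsion) \<or>
    rank_one_by_inversion (G\<lparr>carrier := EL G g\<rparr> Mod torsion))"
proof -
  let ?E = "G\<lparr>carrier := EL G g\<rparr>" and ?C = "power_centralizer g"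
  have E: "subgroup (EL G g) G" using g by (rule subgroup_EL)
  have C: "subgroup ?C G" using g by (rule subgroup_power_centralizer)
  interpret E: group ?E using E by (rule subgroup_imp_group)
  have CE: "subgroup ?C ?E" by (rule subgroup_incl[OF C E power_centralizer_subset_EL])
  have out: "x \<in> carrier G \<and> acts_on_power g x (-1)" if "x \<in> EL G g - ?C" for x
    using that by (auto simp: EL_iff_acts_on_power power_centralizer_def)
  have index2: "x \<otimes>\<^bsub>?E\<^esub> y \<in> ?C" if "x \<in> carrier ?E - ?C" "y \<in> carrier ?E - ?C" for x y
    using out[of x] out[of y] that acts_on_power_mult[OF g, of x y "-1" "-1"] by (simp add: power_centralizer_def)
  have invert: "x \<otimes>\<^bsub>?E\<^esub> a \<otimes>\<^bsub>?E\<^esub> inv\<^bsub>?E\<^esub> x \<in> ?C \<and> slope g (x \<otimes>\<^bsub>?E\<^esub> a \<otimes>\<^bsub>?E\<^esub> inv\<^bsub>?E\<^esub> x) = - slope g a"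
    if "x \<in> carrier ?E - ?C" "a \<in> ?C" for x a
    using out[of x] that slope_conj_inverted[of x a] E by simp
  have g1: "g \<in> ?C" "slope g g \<noteq> 0" using g_pow_in_centralizer[of 1] slope_power[of 1] g by auto
  have add: "slope g (x \<otimes>\<^bsub>?E\<^esub> y) = slope g x + slope g y" if "x \<in> ?C" "y \<in> ?C" for x y
    using slope_mult[OF that] by simp
  note quotient = E.rank_one_or_by_inversion[OF CE add g1 index2 invert, folded torsion_def]
  have "subgroup torsion ?E" using quotient(1) by (rule normal_imp_subgroup)
  then have T: "subgroup torsion G" using incl_subgroup[OF E] by blast
  have "locally_finite (G\<lparr>carrier := torsion\<rparr>)"
    unfolding locally_finite_def using finite_generate_torsion generate_consistent[OF _ T] by auto
  then show ?thesis using quotient by blast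
qed

end

theorem theorem1p4:
  fixes G :: "('a, 'b) monoid_scheme" and g :: 'a
  assumes "lacunary_hyperbolic G"
    and "g \<in> carrier G"
    and "\<And>n::nat. n > 0 \<Longrightarrow> g [^]\<^bsub>G\<^esub> n \<noteq> \<one>\<^bsub>G\<^esub>"
  shows "\<exists>N. N \<lhd> G\<lparr>carrier := EL G g\<rparr> \<and> locally_finite (G\<lparr>carrier := N\<rparr>) \<and>
           (rank_one_abelian (G\<lparr>carrier := EL G g\<rparr> Mod N) \<or>
            rank_one_by_inversion (G\<lparr>carrier := EL G g\<rparr> Mod N))"
proof -
  interpret group G using assms(1) by (simp add: lacunary_hyperbolic_def)
  obtain d where "locally_hyperbolic_group G d" using locally_hyperbolic[OF assms(1)] .
  then interpret H: locally_hyperbolic_group G d .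
  interpret virtually_cyclic_power_centralizers G g
  proof unfold_locales
    fix n :: nat and S
    assume n: "0 < n" and S: "finite S" "S \<subseteq> carrier G" "\<And>s. s \<in> S \<Longrightarrow> s \<otimes>\<^bsub>G\<^esub> g [^]\<^bsub>G\<^esub> n = g [^]\<^bsub>G\<^esub> n \<otimes>\<^bsub>G\<^esub> s"
    have "(g [^]\<^bsub>G\<^esub> n) [^]\<^bsub>G\<^esub> k \<noteq> \<one>\<^bsub>G\<^esub>" if "k > 0" for k :: nat
      using assms(3)[of "n * k"] n that assms(2) by (simp add: nat_pow_pow)
    then show "\<exists>F\<subseteq>carrier G. finite F \<and>
        (\<forall>y\<in>generate G S. \<exists>j::int. \<exists>z\<in>F. y = (g [^]\<^bsub>G\<^esub> n) [^]\<^bsub>G\<^esub> j \<otimes>\<^bsub>G\<^esub> z)"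
      using H.finite_modulo_central_powers[OF nat_pow_closed[OF assms(2)] _ S] by blast
  qed (use assms(2,3) in auto)
  show ?thesis using EL_structure by blast
qed

end
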